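(* Let $(A,\mu_1,\mu_2,\alpha)$ be a compatible Hom-associative algebra and $(M,\ell_1,r_1,\ell_2,r_2,\beta)$ a compatible $A$-bimodule. Let $A_c$ be the compatible Hom-Lie algebra obtained from $A$ by taking commutators and $M_c$ the induced compatible $A_c$-representation. Then the standard skew-symmetrization $$\Theta_n:C^{n,c}_{\alpha,\beta}(A,M)\to C^{n,cL}_{\alpha,\beta}(A_c,M_c),\quad (f_1,\dots,f_n)\mapsto(\overline{f_1},\dots,\overline{f_n}),\quad n\ge1,$$ where $\overline{f_i}(a_1,\dots,a_n)=\sum_{\sigma\in\mathbb S_n}(-1)^\sigma f_i(a_{\sigma(1)},\dots,a_{\sigma(n)})$ for $i=1,\dots,n$, is a morphism of cochain complexes. Hence it induces a map $\Theta^\ast:H^{\ast,c}_{\alpha,\beta}(A,M)\to H^{\ast,cL}_{\alpha,\beta}(A_c,M_c)$.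
   Context: $\mathbb K$ is a field of characteristic $0$; all vector spaces are finite-dimensional over $\mathbb K$. Hom-associative side. A Hom-associative algebra $(A,\mu,\alpha)$: bilinear $\mu(a,b)=a\cdot b$ and linear $\alpha:A\to A$ with $\alpha(a\cdot b)=\alpha(a)\cdot\alpha(b)$ and $(a\cdot b)\cdot\alpha(c)=\alpha(a)\cdot(b\cdot c)$. A bimodule $(M,\ell,r,\beta)$ over it: bilinear $\ell(a,m)=a\lhd m$, $r(m,a)=m\rhd a$ and a linear map $\beta:M\to M$ (assumed invertible) with $\beta(a\lhd m)=\alpha(a)\lhd\beta(m)$, $\beta(m\rhd a)=\beta(m)\rhd\alpha(a)$, $(a\cdot b)\lhd\beta(m)=\alpha(a)\lhd(b\lhd m)$, $(a\lhd m)\rhd\alpha(b)=\alpha(a)\lhd(m\rhd b)$, $(m\rhd a)\rhd\alpha(b)=\beta(m)\rhd(a\cdot b)$. A compatible Hom-associative algebra $(A,\mu_1,\mu_2,\alpha)$: both $(A,\mu_k,\alpha)$ are Hom-associative and $(a\cdot_1 b)\cdot_2\alpha(c)+(a\cdot_2 b)\cdot_1\alpha(c)=\alpha(a)\cdot_1(b\cdot_2 c)+\alpha(a)\cdot_2(b\cdot_1 c)$. A compatible $A$-bimodule $(M,\ell_1,r_1,\ell_2,r_2,\beta)$: $(M,\ell_k,r_k,\beta)$ is a bimodule over $(A,\mu_k,\alpha)$ for $k=1,2$ and $(a\cdot_1b)\lhd_2\beta(m)+(a\cdot_2b)\lhd_1\beta(m)=\alpha(a)\lhd_1(b\lhd_2m)+\alpha(a)\lhd_2(b\lhd_1m)$,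 $(a\lhd_1m)\rhd_2\alpha(b)+(a\lhd_2m)\rhd_1\alpha(b)=\alpha(a)\lhd_1(m\rhd_2b)+\alpha(a)\lhd_2(m\rhd_1b)$, $(m\rhd_1a)\rhd_2\alpha(b)+(m\rhd_2a)\rhd_1\alpha(b)=\beta(m)\rhd_1(a\cdot_2b)+\beta(m)\rhd_2(a\cdot_1b)$. For $n\ge1$, $C^n_{\alpha,\beta}(A,M)=\{f:A^{\otimes n}\to M\text{ linear}\mid \beta\circ f=f\circ\alpha^{\otimes n}\}$, and for $k=1,2$, ${}^k\delta_{\alpha,\beta}:C^n_{\alpha,\beta}(A,M)\to C^{n+1}_{\alpha,\beta}(A,M)$ is $$({}^k\delta_{\alpha,\beta}f)(a_1,\dots,a_{n+1})=\alpha^{n-1}(a_1)\lhd_kf(a_2,\dots,a_{n+1})+\sum_{i=1}^n(-1)^if(\alpha(a_1),\dots,\alpha(a_{i-1}),a_i\cdot_ka_{i+1},\alpha(a_{i+2}),\dots,\alpha(a_{n+1}))+(-1)^{n+1}f(a_1,\dots,a_n)\rhd_k\alpha^{n-1}(a_{n+1}).$$ $C^{n,c}_{\alpha,\beta}(A,M)$ is the direct sum of $n$ copies of $C^n_{\alpha,\beta}(A,M)$, with differential $\delta^{n,c}_{\alpha,\beta}(f_1,\dots,f_n)=({}^1\delta f_1,\,{}^2\delta f_1+{}^1\delta f_2,\dots,{}^2\delta f_{n-1}+{}^1\delta f_n,\,{}^2\delta f_n)$ (where ${}^k\delta={}^k\delta_{\alpha,\beta}$); its cohomology is $H^{\ast,c}_{\alpha,\beta}(A,M)$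 (degrees $n\ge1$). Hom-Lie side. A Hom-Lie algebra $(\mathfrak g,[\cdot,\cdot],\alpha)$: a skew-symmetric bilinear bracket and linear $\alpha$ with $\alpha[x,y]=[\alpha(x),\alpha(y)]$ and $[[x,y],\alpha(z)]+[[y,z],\alpha(x)]+[[z,x],\alpha(y)]=0$. A representation $(V,\rho,\beta)$: linear $\rho:\mathfrak g\to\mathrm{End}(V)$ and $\beta:V\to V$ with $\beta(\rho(x)v)=\rho(\alpha(x))\beta(v)$ and $\rho([x,y])\beta(v)=\rho(\alpha(x))\rho(y)v-\rho(\alpha(y))\rho(x)v$. A compatible Hom-Lie algebra $(\mathfrak g,[\cdot,\cdot]_1,[\cdot,\cdot]_2,\alpha)$: both brackets are Hom-Lie with twisting map $\alpha$ and $[[x,y]_1,\alpha(z)]_2+[[y,z]_1,\alpha(x)]_2+[[z,x]_1,\alpha(y)]_2+[[x,y]_2,\alpha(z)]_1+[[y,z]_2,\alpha(x)]_1+[[z,x]_2,\alpha(y)]_1=0$. A compatible representation $(V,\rho_1,\rho_2,\beta)$: $(V,\rho_k,\beta)$ is a representation of $(\mathfrak g,[\cdot,\cdot]_k,\alpha)$ and $\rho_2([x,y]_1)\beta(v)+\rho_1([x,y]_2)\beta(v)=\rho_1(\alpha(x))\rho_2(y)v-\rho_1(\alpha(y))\rho_2(x)v+\rho_2(\alpha(x))\rho_1(y)v-\rho_2(\alpha(y))\rho_1(x)v$. $C^{n,L}_{\alpha,\beta}(\mathfrak g,V)=\{f\in\mathrm{Hom}(\wedge^n\mathfrak g,V)\mid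 f\circ\alpha^{\otimes n}=\beta\circ f\}$ and ${}^kd^{n,L}_{\alpha,\beta}$ is the Chevalley-Eilenberg coboundary of $(\mathfrak g,[\cdot,\cdot]_k,\alpha)$ with coefficients in $(V,\rho_k,\beta)$: $$({}^kd\,f)(x_1,\dots,x_{n+1})=\sum_{i=1}^{n+1}(-1)^{i+1}\rho_k(\alpha^{n-1}(x_i))f(x_1,\dots,\widehat{x_i},\dots,x_{n+1})+\sum_{i<j}(-1)^{i+j}f([x_i,x_j]_k,\alpha(x_1),\dots,\widehat{\alpha(x_i)},\dots,\widehat{\alpha(x_j)},\dots,\alpha(x_{n+1})).$$ $C^{n,cL}_{\alpha,\beta}(\mathfrak g,V)$ is the direct sum of $n$ copies of $C^{n,L}_{\alpha,\beta}(\mathfrak g,V)$ ($n\ge1$), with differential $d^{n,cL}_{\alpha,\beta}(f_1,\dots,f_n)=({}^1df_1,\,{}^1df_2+{}^2df_1,\dots,{}^1df_n+{}^2df_{n-1},\,{}^2df_n)$; its cohomology is $H^{\ast,cL}_{\alpha,\beta}(\mathfrak g,V)$. $A_c$ is $A$ with $[a,b]_k=a\cdot_kb-b\cdot_ka$ ($k=1,2$) and twisting map $\alpha$; $M_c$ is $M$ with $\rho_k(a)(m)=a\lhd_km-m\rhd_ka$ ($k=1,2$) and the map $\beta$. *)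

theory Defs
  imports
    Complex_Main
    "HOL-Library.FuncSet"
    "HOL-Library.Function_Algebras"
    "HOL-Combinatorics.Permutations"
begin

section \<open>Linear, bilinear and multilinear maps\<close>

definition bilinear_map ::
  "('k::field \<Rightarrow> 'a::ab_group_add \<Rightarrow> 'a) \<Rightarrow> ('k \<Rightarrow> 'b::ab_group_add \<Rightarrow> 'b) \<Rightarrow>
   ('k \<Rightarrow> 'c::ab_group_add \<Rightarrow> 'c) \<Rightarrow> ('a \<Rightarrow> 'b \<Rightarrow> 'c) \<Rightarrow> bool" where
  "bilinear_map s1 s2 s3 f \<longleftrightarrow>
     (\<forall>x. Vector_Spaces.linear s2 s3 (f x)) \<and> (\<forall>y. Vector_Spaces.linear s1 s3 (\<lambda>x. f x y))"

definition linear_map_on ::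
  "('k \<Rightarrow> 'v \<Rightarrow> 'v) \<Rightarrow> ('k \<Rightarrow> 'w \<Rightarrow> 'w) \<Rightarrow> 'v::plus set \<Rightarrow> ('v \<Rightarrow> 'w::plus) \<Rightarrow> bool" where
  "linear_map_on s s' V f \<longleftrightarrow>
     (\<forall>x\<in>V. \<forall>y\<in>V. f (x + y) = f x + f y) \<and> (\<forall>c. \<forall>x\<in>V. f (s c x) = s' c (f x))"

text \<open>
  A linear map on the \<open>n\<close>-fold tensor power is identified with a multilinear map in \<open>n\<close>
  arguments. The arguments form a list of length \<open>n\<close>; the value on lists of any other length is
  fixed to be \<open>0\<close>, so that equality of functions is equality of cochains.
\<close>

definition multilinear_maps ::
  "('k::field \<Rightarrow> 'a::ab_group_add \<Rightarrow> 'a) \<Rightarrow> ('k \<Rightarrow> 'm::ab_group_add \<Rightarrow> 'm) \<Rightarrow> nat \<Rightarrow>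
   ('a list \<Rightarrow> 'm) set" where
  "multilinear_maps sA sM n =
     {f. (\<forall>xs. length xs \<noteq> n \<longrightarrow> f xs = 0) \<and>
         (\<forall>xs i. length xs = n \<longrightarrow> i < n \<longrightarrow> Vector_Spaces.linear sA sM (\<lambda>a. f (xs[i := a])))}"

text \<open>Linear maps on the \<open>n\<close>-th exterior power are identified with alternating multilinear maps.\<close>

definition alternating_maps ::
  "('k::field \<Rightarrow> 'a::ab_group_add \<Rightarrow> 'a) \<Rightarrow> ('k \<Rightarrow> 'm::ab_group_add \<Rightarrow> 'm) \<Rightarrow> nat \<Rightarrow>
   ('a list \<Rightarrow> 'm) set" where
  "alternating_maps sA sM n =
     {f \<in> multilinear_maps sA sM n.
        \<forall>xs i j. length xs = n \<longrightarrow> i < j \<longrightarrow> j < n \<longrightarrow> xs ! i = xs ! j \<longrightarrow> f xs = 0}"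


section \<open>Compatible Hom-associative algebras and bimodules\<close>

locale hom_assoc_algebra =
  fixes sA :: "'k::field_char_0 \<Rightarrow> 'a::ab_group_add \<Rightarrow> 'a"
    and \<mu> :: "'a \<Rightarrow> 'a \<Rightarrow> 'a" and \<alpha> :: "'a \<Rightarrow> 'a"
  assumes bilinear_mult: "bilinear_map sA sA sA \<mu>"
    and linear_twist: "Vector_Spaces.linear sA sA \<alpha>"
    and twist_mult: "\<alpha> (\<mu> a b) = \<mu> (\<alpha> a) (\<alpha> b)"
    and hom_assoc: "\<mu> (\<mu> a b) (\<alpha> c) = \<mu> (\<alpha> a) (\<mu> b c)"

text \<open>Arguments as in the actions: \<open>l a m\<close> is \<open>a \<lhd> m\<close> and \<open>r m a\<close> is \<open>m \<rhd> a\<close>.\<close>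

locale hom_bimodule = hom_assoc_algebra sA \<mu> \<alpha>
  for sA :: "'k::field_char_0 \<Rightarrow> 'a::ab_group_add \<Rightarrow> 'a"
    and sM :: "'k \<Rightarrow> 'm::ab_group_add \<Rightarrow> 'm"
    and \<mu> :: "'a \<Rightarrow> 'a \<Rightarrow> 'a" and \<alpha> :: "'a \<Rightarrow> 'a"
    and l :: "'a \<Rightarrow> 'm \<Rightarrow> 'm" and r :: "'m \<Rightarrow> 'a \<Rightarrow> 'm" and \<beta> :: "'m \<Rightarrow> 'm" +
  assumes bilinear_left: "bilinear_map sA sM sM l"
    and bilinear_right: "bilinear_map sM sA sM r"
    and linear_mod_twist: "Vector_Spaces.linear sM sM \<beta>"
    and bij_mod_twist: "bij \<beta>"
    and twist_left: "\<beta> (l a m) = l (\<alpha> a) (\<beta> m)"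
    and twist_right: "\<beta> (r m a) = r (\<beta> m) (\<alpha> a)"
    and left_left: "l (\<mu> a b) (\<beta> m) = l (\<alpha> a) (l b m)"
    and left_right: "r (l a m) (\<alpha> b) = l (\<alpha> a) (r m b)"
    and right_right: "r (r m a) (\<alpha> b) = r (\<beta> m) (\<mu> a b)"

locale compatible_hom_assoc_algebra =
  alg1: hom_assoc_algebra sA \<mu>1 \<alpha> + alg2: hom_assoc_algebra sA \<mu>2 \<alpha>
  for sA :: "'k::field_char_0 \<Rightarrow> 'a::ab_group_add \<Rightarrow> 'a"
    and \<mu>1 \<mu>2 :: "'a \<Rightarrow> 'a \<Rightarrow> 'a" and \<alpha> :: "'a \<Rightarrow> 'a" +
  assumes compatible_mult:
    "\<mu>2 (\<mu>1 a b) (\<alpha> c) + \<mu>1 (\<mu>2 a b) (\<alpha> c) = \<mu>1 (\<alpha> a) (\<mu>2 b c) + \<mu>2 (\<alpha> a) (\<mu>1 b c)"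

locale compatible_hom_bimodule =
  compatible_hom_assoc_algebra sA \<mu>1 \<mu>2 \<alpha> +
  mod1: hom_bimodule sA sM \<mu>1 \<alpha> l1 r1 \<beta> +
  mod2: hom_bimodule sA sM \<mu>2 \<alpha> l2 r2 \<beta>
  for sA :: "'k::field_char_0 \<Rightarrow> 'a::ab_group_add \<Rightarrow> 'a"
    and sM :: "'k \<Rightarrow> 'm::ab_group_add \<Rightarrow> 'm"
    and \<mu>1 \<mu>2 :: "'a \<Rightarrow> 'a \<Rightarrow> 'a" and \<alpha> :: "'a \<Rightarrow> 'a"
    and l1 :: "'a \<Rightarrow> 'm \<Rightarrow> 'm" and r1 :: "'m \<Rightarrow> 'a \<Rightarrow> 'm"
    and l2 :: "'a \<Rightarrow> 'm \<Rightarrow> 'm" and r2 :: "'m \<Rightarrow> 'a \<Rightarrow> 'm"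
    and \<beta> :: "'m \<Rightarrow> 'm" +
  assumes compatible_left_left:
      "l2 (\<mu>1 a b) (\<beta> m) + l1 (\<mu>2 a b) (\<beta> m) = l1 (\<alpha> a) (l2 b m) + l2 (\<alpha> a) (l1 b m)"
    and compatible_left_right:
      "r2 (l1 a m) (\<alpha> b) + r1 (l2 a m) (\<alpha> b) = l1 (\<alpha> a) (r2 m b) + l2 (\<alpha> a) (r1 m b)"
    and compatible_right_right:
      "r2 (r1 m a) (\<alpha> b) + r1 (r2 m a) (\<alpha> b) = r1 (\<beta> m) (\<mu>2 a b) + r2 (\<beta> m) (\<mu>1 a b)"


section \<open>Compatible Hom-Lie algebras and representations\<close>

locale hom_lie_algebra =
  fixes sG :: "'k::field_char_0 \<Rightarrow> 'g::ab_group_add \<Rightarrow> 'g"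
    and br :: "'g \<Rightarrow> 'g \<Rightarrow> 'g" and \<alpha> :: "'g \<Rightarrow> 'g"
  assumes bilinear_bracket: "bilinear_map sG sG sG br"
    and skew_bracket: "br x y = - br y x"
    and linear_twist: "Vector_Spaces.linear sG sG \<alpha>"
    and twist_bracket: "\<alpha> (br x y) = br (\<alpha> x) (\<alpha> y)"
    and hom_jacobi: "br (br x y) (\<alpha> z) + br (br y z) (\<alpha> x) + br (br z x) (\<alpha> y) = 0"

text \<open>
  Bilinearity of \<open>\<rho>\<close> says that \<open>\<rho>\<close> is a linear map with values in the linear endomorphisms.
\<close>

locale hom_lie_representation = hom_lie_algebra sG br \<alpha>
  for sG :: "'k::field_char_0 \<Rightarrow> 'g::ab_group_add \<Rightarrow> 'g"
    and sV :: "'k \<Rightarrow> 'v::ab_group_add \<Rightarrow> 'v"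
    and br :: "'g \<Rightarrow> 'g \<Rightarrow> 'g" and \<alpha> :: "'g \<Rightarrow> 'g"
    and \<rho> :: "'g \<Rightarrow> 'v \<Rightarrow> 'v" and \<beta> :: "'v \<Rightarrow> 'v" +
  assumes bilinear_rep: "bilinear_map sG sV sV \<rho>"
    and linear_rep_twist: "Vector_Spaces.linear sV sV \<beta>"
    and twist_rep: "\<beta> (\<rho> x v) = \<rho> (\<alpha> x) (\<beta> v)"
    and rep_bracket: "\<rho> (br x y) (\<beta> v) = \<rho> (\<alpha> x) (\<rho> y v) - \<rho> (\<alpha> y) (\<rho> x v)"

locale compatible_hom_lie_algebra =
  lie1: hom_lie_algebra sG br1 \<alpha> + lie2: hom_lie_algebra sG br2 \<alpha>
  for sG :: "'k::field_char_0 \<Rightarrow> 'g::ab_group_add \<Rightarrow> 'g"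
    and br1 br2 :: "'g \<Rightarrow> 'g \<Rightarrow> 'g" and \<alpha> :: "'g \<Rightarrow> 'g" +
  assumes compatible_jacobi:
    "br2 (br1 x y) (\<alpha> z) + br2 (br1 y z) (\<alpha> x) + br2 (br1 z x) (\<alpha> y) +
     br1 (br2 x y) (\<alpha> z) + br1 (br2 y z) (\<alpha> x) + br1 (br2 z x) (\<alpha> y) = 0"

locale compatible_hom_lie_representation =
  compatible_hom_lie_algebra sG br1 br2 \<alpha> +
  rep1: hom_lie_representation sG sV br1 \<alpha> \<rho>1 \<beta> +
  rep2: hom_lie_representation sG sV br2 \<alpha> \<rho>2 \<beta>
  for sG :: "'k::field_char_0 \<Rightarrow> 'g::ab_group_add \<Rightarrow> 'g"
    and sV :: "'k \<Rightarrow> 'v::ab_group_add \<Rightarrow> 'v"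
    and br1 br2 :: "'g \<Rightarrow> 'g \<Rightarrow> 'g" and \<alpha> :: "'g \<Rightarrow> 'g"
    and \<rho>1 \<rho>2 :: "'g \<Rightarrow> 'v \<Rightarrow> 'v" and \<beta> :: "'v \<Rightarrow> 'v" +
  assumes compatible_rep:
    "\<rho>2 (br1 x y) (\<beta> v) + \<rho>1 (br2 x y) (\<beta> v) =
       \<rho>1 (\<alpha> x) (\<rho>2 y v) - \<rho>1 (\<alpha> y) (\<rho>2 x v) + \<rho>2 (\<alpha> x) (\<rho>1 y v) - \<rho>2 (\<alpha> y) (\<rho>1 x v)"

definition commutator :: "('a \<Rightarrow> 'a \<Rightarrow> 'a::ab_group_add) \<Rightarrow> 'a \<Rightarrow> 'a \<Rightarrow> 'a" where
  "commutator \<mu> a b = \<mu> a b - \<mu> b a"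

definition commutator_action ::
  "('a \<Rightarrow> 'm \<Rightarrow> 'm::ab_group_add) \<Rightarrow> ('m \<Rightarrow> 'a \<Rightarrow> 'm) \<Rightarrow> 'a \<Rightarrow> 'm \<Rightarrow> 'm" where
  "commutator_action l r a m = l a m - r m a"


section \<open>Cochain complexes in degrees \<open>n \<ge> 1\<close> and their cohomology\<close>

locale cochain_complex = vector_space s
  for s :: "'k::field \<Rightarrow> 'v::ab_group_add \<Rightarrow> 'v"
    and C :: "nat \<Rightarrow> 'v set" and d :: "nat \<Rightarrow> 'v \<Rightarrow> 'v" +
  assumes subspace_cochains: "n \<ge> 1 \<Longrightarrow> module.subspace s (C n)"
    and differential_into: "n \<ge> 1 \<Longrightarrow> d n \<in> C n \<rightarrow> C (Suc n)"
    and differential_linear: "n \<ge> 1 \<Longrightarrow> linear_map_on s s (C n) (d n)"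
    and differential_square: "n \<ge> 1 \<Longrightarrow> f \<in> C n \<Longrightarrow> d (Suc n) (d n f) = 0"

locale cochain_map =
  source: cochain_complex s C d + target: cochain_complex s' C' d'
  for s :: "'k::field \<Rightarrow> 'v::ab_group_add \<Rightarrow> 'v"
    and C :: "nat \<Rightarrow> 'v set" and d :: "nat \<Rightarrow> 'v \<Rightarrow> 'v"
    and s' :: "'k \<Rightarrow> 'w::ab_group_add \<Rightarrow> 'w"
    and C' :: "nat \<Rightarrow> 'w set" and d' :: "nat \<Rightarrow> 'w \<Rightarrow> 'w"
    and \<theta> :: "nat \<Rightarrow> 'v \<Rightarrow> 'w" +
  assumes map_into: "n \<ge> 1 \<Longrightarrow> \<theta> n \<in> C n \<rightarrow> C' n"
    and map_linear: "n \<ge> 1 \<Longrightarrow> linear_map_on s s' (C n) (\<theta> n)"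
    and map_differential: "n \<ge> 1 \<Longrightarrow> f \<in> C n \<Longrightarrow> \<theta> (Suc n) (d n f) = d' n (\<theta> n f)"

definition cocycles :: "(nat \<Rightarrow> 'v set) \<Rightarrow> (nat \<Rightarrow> 'v \<Rightarrow> 'v::zero) \<Rightarrow> nat \<Rightarrow> 'v set" where
  "cocycles C d n = {f \<in> C n. d n f = 0}"

text \<open>There are no cochains in degree \<open>0\<close>, so the only coboundary in degree \<open>1\<close> is \<open>0\<close>.\<close>

definition coboundaries :: "(nat \<Rightarrow> 'v set) \<Rightarrow> (nat \<Rightarrow> 'v \<Rightarrow> 'v::zero) \<Rightarrow> nat \<Rightarrow> 'v set" where
  "coboundaries C d n = (if n \<le> 1 then {0} else d (n - 1) ` C (n - 1))"

definition cohomologous ::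
  "(nat \<Rightarrow> 'v set) \<Rightarrow> (nat \<Rightarrow> 'v \<Rightarrow> 'v::ab_group_add) \<Rightarrow> nat \<Rightarrow> ('v \<times> 'v) set" where
  "cohomologous C d n =
     {(f, g). f \<in> cocycles C d n \<and> g \<in> cocycles C d n \<and> f - g \<in> coboundaries C d n}"

definition cohomology ::
  "(nat \<Rightarrow> 'v set) \<Rightarrow> (nat \<Rightarrow> 'v \<Rightarrow> 'v::ab_group_add) \<Rightarrow> nat \<Rightarrow> 'v set set" where
  "cohomology C d n = cocycles C d n // cohomologous C d n"

definition cohomology_class ::
  "(nat \<Rightarrow> 'v set) \<Rightarrow> (nat \<Rightarrow> 'v \<Rightarrow> 'v::ab_group_add) \<Rightarrow> nat \<Rightarrow> 'v \<Rightarrow> 'v set" where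
  "cohomology_class C d n f = cohomologous C d n `` {f}"

text \<open>
  The vector space operations of the quotient. The classes united on the right-hand sides all
  coincide when \<open>X\<close> and \<open>Y\<close> are elements of \<open>cohomology C d n\<close>.
\<close>

definition cohomology_add ::
  "(nat \<Rightarrow> 'v set) \<Rightarrow> (nat \<Rightarrow> 'v \<Rightarrow> 'v::ab_group_add) \<Rightarrow> nat \<Rightarrow> 'v set \<Rightarrow> 'v set \<Rightarrow> 'v set" where
  "cohomology_add C d n X Y = (\<Union>f\<in>X. \<Union>g\<in>Y. cohomology_class C d n (f + g))"

definition cohomology_scale ::
  "('k \<Rightarrow> 'v \<Rightarrow> 'v) \<Rightarrow> (nat \<Rightarrow> 'v set) \<Rightarrow> (nat \<Rightarrow> 'v \<Rightarrow> 'v::ab_group_add) \<Rightarrow> nat \<Rightarrow>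
   'k \<Rightarrow> 'v set \<Rightarrow> 'v set" where
  "cohomology_scale s C d n c X = (\<Union>f\<in>X. cohomology_class C d n (s c f))"


section \<open>Tuples of cochains\<close>

text \<open>
  An element \<open>(f\<^sub>1, \<dots>, f\<^sub>n)\<close> of the direct sum of \<open>n\<close> copies of a cochain space is a
  function \<open>F\<close> with \<open>F i = f\<^sub>i\<close> for \<open>1 \<le> i \<le> n\<close> and \<open>F i = 0\<close> for all other \<open>i\<close>. Addition, zero
  and subtraction of tuples are the pointwise ones.
\<close>

definition tuples :: "(nat \<Rightarrow> ('a list \<Rightarrow> 'm::zero) set) \<Rightarrow> nat \<Rightarrow> (nat \<Rightarrow> 'a list \<Rightarrow> 'm) set" where
  "tuples C n = {F. (\<forall>i\<in>{1..n}. F i \<in> C n) \<and> (\<forall>i. i \<notin> {1..n} \<longrightarrow> F i = 0)}"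

definition tuple_scale ::
  "('k \<Rightarrow> 'm \<Rightarrow> 'm) \<Rightarrow> 'k \<Rightarrow> (nat \<Rightarrow> 'a list \<Rightarrow> 'm) \<Rightarrow> nat \<Rightarrow> 'a list \<Rightarrow> 'm" where
  "tuple_scale sM c F = (\<lambda>i xs. sM c (F i xs))"

text \<open>The tuple \<open>(d1 f\<^sub>1, d2 f\<^sub>1 + d1 f\<^sub>2, \<dots>, d2 f\<^bsub>n-1\<^esub> + d1 f\<^sub>n, d2 f\<^sub>n)\<close> of length \<open>n + 1\<close>.\<close>

definition tuple_differential ::
  "(nat \<Rightarrow> ('a list \<Rightarrow> 'm::ab_group_add) \<Rightarrow> 'a list \<Rightarrow> 'm) \<Rightarrow>
   (nat \<Rightarrow> ('a list \<Rightarrow> 'm) \<Rightarrow> 'a list \<Rightarrow> 'm) \<Rightarrow>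
   nat \<Rightarrow> (nat \<Rightarrow> 'a list \<Rightarrow> 'm) \<Rightarrow> nat \<Rightarrow> 'a list \<Rightarrow> 'm" where
  "tuple_differential d1 d2 n F =
     (\<lambda>i. if i = 1 then d1 n (F 1)
          else if 2 \<le> i \<and> i \<le> n then d2 n (F (i - 1)) + d1 n (F i)
          else if i = n + 1 then d2 n (F n)
          else 0)"


section \<open>The two cochain complexes\<close>

definition hom_assoc_cochains ::
  "('k::field \<Rightarrow> 'a::ab_group_add \<Rightarrow> 'a) \<Rightarrow> ('k \<Rightarrow> 'm::ab_group_add \<Rightarrow> 'm) \<Rightarrow>
   ('a \<Rightarrow> 'a) \<Rightarrow> ('m \<Rightarrow> 'm) \<Rightarrow> nat \<Rightarrow> ('a list \<Rightarrow> 'm) set" where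
  "hom_assoc_cochains sA sM \<alpha> \<beta> n =
     {f \<in> multilinear_maps sA sM n. \<forall>xs. length xs = n \<longrightarrow> \<beta> (f xs) = f (map \<alpha> xs)}"

text \<open>
  The entry \<open>xs ! i\<close> is the argument \<open>a\<^bsub>i+1\<^esub>\<close>; the summation index below is thus one less than
  the usual one.
\<close>

definition hom_assoc_differential ::
  "('k::field \<Rightarrow> 'm::ab_group_add \<Rightarrow> 'm) \<Rightarrow> ('a \<Rightarrow> 'a \<Rightarrow> 'a) \<Rightarrow> ('a \<Rightarrow> 'a) \<Rightarrow>
   ('a \<Rightarrow> 'm \<Rightarrow> 'm) \<Rightarrow> ('m \<Rightarrow> 'a \<Rightarrow> 'm) \<Rightarrow> nat \<Rightarrow> ('a list \<Rightarrow> 'm) \<Rightarrow> 'a list \<Rightarrow> 'm" where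
  "hom_assoc_differential sM \<mu> \<alpha> l r n f =
     (\<lambda>xs. if length xs = n + 1 then
        l ((\<alpha> ^^ (n - 1)) (hd xs)) (f (tl xs))
        + (\<Sum>i<n. sM ((-1) ^ (i + 1))
             (f (map \<alpha> (take i xs) @ [\<mu> (xs ! i) (xs ! (i + 1))] @ map \<alpha> (drop (i + 2) xs))))
        + sM ((-1) ^ (n + 1)) (r (f (butlast xs)) ((\<alpha> ^^ (n - 1)) (last xs)))
      else 0)"

definition hom_lie_cochains ::
  "('k::field \<Rightarrow> 'g::ab_group_add \<Rightarrow> 'g) \<Rightarrow> ('k \<Rightarrow> 'v::ab_group_add \<Rightarrow> 'v) \<Rightarrow>
   ('g \<Rightarrow> 'g) \<Rightarrow> ('v \<Rightarrow> 'v) \<Rightarrow> nat \<Rightarrow> ('g list \<Rightarrow> 'v) set" where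
  "hom_lie_cochains sG sV \<alpha> \<beta> n =
     {f \<in> alternating_maps sG sV n. \<forall>xs. length xs = n \<longrightarrow> f (map \<alpha> xs) = \<beta> (f xs)}"

text \<open>
  Again indices start at \<open>0\<close>, which turns the sign \<open>(-1)\<^bsup>i+1\<^esup>\<close> into \<open>(-1)\<^bsup>i\<^esup>\<close> and does not
  affect \<open>(-1)\<^bsup>i+j\<^esup>\<close>. The list \<open>nths xs (- I)\<close> is \<open>xs\<close> with the entries at positions in \<open>I\<close> omitted.
\<close>

definition hom_lie_differential ::
  "('k::field \<Rightarrow> 'v::ab_group_add \<Rightarrow> 'v) \<Rightarrow> ('g \<Rightarrow> 'g \<Rightarrow> 'g) \<Rightarrow> ('g \<Rightarrow> 'g) \<Rightarrow>
   ('g \<Rightarrow> 'v \<Rightarrow> 'v) \<Rightarrow> nat \<Rightarrow> ('g list \<Rightarrow> 'v) \<Rightarrow> 'g list \<Rightarrow> 'v" where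
  "hom_lie_differential sV br \<alpha> \<rho> n f =
     (\<lambda>xs. if length xs = n + 1 then
        (\<Sum>i<n + 1. sV ((-1) ^ i) (\<rho> ((\<alpha> ^^ (n - 1)) (xs ! i)) (f (nths xs (- {i})))))
        + (\<Sum>j<n + 1. \<Sum>i<j. sV ((-1) ^ (i + j))
             (f (br (xs ! i) (xs ! j) # map \<alpha> (nths xs (- {i, j})))))
      else 0)"

definition compatible_assoc_cochains ::
  "('k::field \<Rightarrow> 'a::ab_group_add \<Rightarrow> 'a) \<Rightarrow> ('k \<Rightarrow> 'm::ab_group_add \<Rightarrow> 'm) \<Rightarrow>
   ('a \<Rightarrow> 'a) \<Rightarrow> ('m \<Rightarrow> 'm) \<Rightarrow> nat \<Rightarrow> (nat \<Rightarrow> 'a list \<Rightarrow> 'm) set" where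
  "compatible_assoc_cochains sA sM \<alpha> \<beta> = tuples (hom_assoc_cochains sA sM \<alpha> \<beta>)"

definition compatible_assoc_differential ::
  "('k::field \<Rightarrow> 'm::ab_group_add \<Rightarrow> 'm) \<Rightarrow> ('a \<Rightarrow> 'a \<Rightarrow> 'a) \<Rightarrow> ('a \<Rightarrow> 'a \<Rightarrow> 'a) \<Rightarrow> ('a \<Rightarrow> 'a) \<Rightarrow>
   ('a \<Rightarrow> 'm \<Rightarrow> 'm) \<Rightarrow> ('m \<Rightarrow> 'a \<Rightarrow> 'm) \<Rightarrow> ('a \<Rightarrow> 'm \<Rightarrow> 'm) \<Rightarrow> ('m \<Rightarrow> 'a \<Rightarrow> 'm) \<Rightarrow>
   nat \<Rightarrow> (nat \<Rightarrow> 'a list \<Rightarrow> 'm) \<Rightarrow> nat \<Rightarrow> 'a list \<Rightarrow> 'm" where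
  "compatible_assoc_differential sM \<mu>1 \<mu>2 \<alpha> l1 r1 l2 r2 =
     tuple_differential
       (hom_assoc_differential sM \<mu>1 \<alpha> l1 r1) (hom_assoc_differential sM \<mu>2 \<alpha> l2 r2)"

definition compatible_lie_cochains ::
  "('k::field \<Rightarrow> 'g::ab_group_add \<Rightarrow> 'g) \<Rightarrow> ('k \<Rightarrow> 'v::ab_group_add \<Rightarrow> 'v) \<Rightarrow>
   ('g \<Rightarrow> 'g) \<Rightarrow> ('v \<Rightarrow> 'v) \<Rightarrow> nat \<Rightarrow> (nat \<Rightarrow> 'g list \<Rightarrow> 'v) set" where
  "compatible_lie_cochains sG sV \<alpha> \<beta> = tuples (hom_lie_cochains sG sV \<alpha> \<beta>)"

definition compatible_lie_differential ::
  "('k::field \<Rightarrow> 'v::ab_group_add \<Rightarrow> 'v) \<Rightarrow> ('g \<Rightarrow> 'g \<Rightarrow> 'g) \<Rightarrow> ('g \<Rightarrow> 'g \<Rightarrow> 'g) \<Rightarrow> ('g \<Rightarrow> 'g) \<Rightarrow>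
   ('g \<Rightarrow> 'v \<Rightarrow> 'v) \<Rightarrow> ('g \<Rightarrow> 'v \<Rightarrow> 'v) \<Rightarrow>
   nat \<Rightarrow> (nat \<Rightarrow> 'g list \<Rightarrow> 'v) \<Rightarrow> nat \<Rightarrow> 'g list \<Rightarrow> 'v" where
  "compatible_lie_differential sV br1 br2 \<alpha> \<rho>1 \<rho>2 =
     tuple_differential
       (hom_lie_differential sV br1 \<alpha> \<rho>1) (hom_lie_differential sV br2 \<alpha> \<rho>2)"


section \<open>Skew-symmetrization\<close>

definition skew_symmetrization ::
  "('k::field \<Rightarrow> 'm::ab_group_add \<Rightarrow> 'm) \<Rightarrow> nat \<Rightarrow> ('a list \<Rightarrow> 'm) \<Rightarrow> 'a list \<Rightarrow> 'm" where
  "skew_symmetrization sM n f =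
     (\<lambda>xs. if length xs = n
           then \<Sum>\<sigma> | \<sigma> permutes {..<n}. sM (of_int (sign \<sigma>)) (f (permute_list \<sigma> xs))
           else 0)"

definition skew_map ::
  "('k::field \<Rightarrow> 'm::ab_group_add \<Rightarrow> 'm) \<Rightarrow> nat \<Rightarrow>
   (nat \<Rightarrow> 'a list \<Rightarrow> 'm) \<Rightarrow> nat \<Rightarrow> 'a list \<Rightarrow> 'm" where
  "skew_map sM n F = (\<lambda>i. skew_symmetrization sM n (F i))"

end

theory Submission
  imports Defs "Jordan_Normal_Form.Determinant"
begin

text \<open>
  Write \<open>\<Theta>\<close> for skew-symmetrization and \<open>\<delta>\<close>, \<open>d\<close>
      for the two differentials belonging to a single bimodule
  and its commutator representation. Everything rests on two facts about a single structure:
  \<open>\<delta> \<delta> = 0\<close> and \<open>\<Theta> \<delta> = d \<Theta>\<close>.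

  For \<open>\<Theta> \<delta> = d \<Theta>\<close>, a signed sum over permutations obeys the Laplace expansions of a determinant:
      one may
  sort the permutations by the argument that lands in a fixed position (row), or by the position to
  which a fixed argument is sent (column). The row expansions at the first and at the last position
  turn the two outer terms of \<open>\<delta>\<close> into the action \<open>l - r\<close>. In an inner term, which multiplies the
  entries at positions \<open>q\<close> and \<open>q + 1\<close>, two successive row expansions at \<open>q\<close> choose an ordered
      pair of
  arguments; the two orders of a pair carry opposite signs and combine to a commutator at position
  \<open>q\<close>. Summed over \<open>q\<close>, this is the column expansion of \<open>\<Theta> f\<close> along its bracket argument
  (\<open>skew_symmetrization_differential\<close>).

  The differential \<open>\<delta>\<close> is the alternating sum of cofaces satisfying the cosimplicial identities,
      which
  gives \<open>\<delta> \<delta> = 0\<close> (\<open>hom_assoc_differential_square\<close>). Two compatible structures have a sum, which is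
  again a Hom-bimodule and has differential \<open>\<delta>1 + \<delta>2\<close>; expanding the square of this sum shows
  that \<open>\<delta>1\<close> and \<open>\<delta>2\<close> anticommute (\<open>hom_assoc_differentials_anticommute\<close>), so tuples form a complex.

  On the Lie side nothing has to be expanded again: an alternating map satisfies \<open>\<Theta> f = n! f\<close>, so in
  characteristic zero \<open>\<Theta>\<close> maps the Hom-associative cochains onto the Hom-Lie cochains,
      and the axioms of
  a complex pass from the source to the target of a surjection that commutes with the differentials
  (\<open>cochain_map_onto\<close>). The map on cohomology is then the usual one
  (\<open>ex1_induced_map_on_cohomology\<close>).
\<close>


section \<open>Spaces of cochains\<close>

lemma linear_compose_fun:
  "Vector_Spaces.linear s1 s2 f \<Longrightarrow> Vector_Spaces.linear s2 s3 g \<Longrightarrow>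
      Vector_Spaces.linear s1 s3 (\<lambda>x. g (f x))"
  using Vector_Spaces.linear_compose[of s1 s2 f s3 g] by (simp add: o_def)

lemma multilinear_maps_linear:
  "f \<in> multilinear_maps sA sM n \<Longrightarrow> length xs = n \<Longrightarrow> i < n \<Longrightarrow>
     Vector_Spaces.linear sA sM (\<lambda>a. f (xs[i := a]))"
  by (simp add: multilinear_maps_def)

lemma sum_fun_apply: "sum F A x = (\<Sum>i\<in>A. F i x)"
  by (induction A rule: infinite_finite_induct) auto

lemma vector_space_cochain_scale:
  assumes "vector_space sM"
  shows "vector_space (\<lambda>c (f :: 'a list \<Rightarrow> 'm::ab_group_add) xs. sM c (f xs))"
proof -
  interpret M: vector_space sM by fact
  show ?thesis
    by unfold_locales (auto simp: fun_eq_iff algebra_simps)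
qed

lemma subspace_hom_assoc_cochains:
  fixes sA :: "'k::field \<Rightarrow> 'a::ab_group_add \<Rightarrow> 'a" and sM :: "'k \<Rightarrow> 'm::ab_group_add \<Rightarrow> 'm"
  assumes A: "vector_space sA" and \<beta>: "Vector_Spaces.linear sM sM \<beta>"
  shows "module.subspace (\<lambda>c f xs. sM c (f xs)) (hom_assoc_cochains sA sM \<alpha> \<beta> n)"
proof -
  interpret \<beta>: Vector_Spaces.linear sM sM \<beta> by fact
  interpret P: vector_space_pair sA sM
    using A \<beta>.vs1.vector_space_axioms by (simp add: vector_space_pair_def)
  interpret F: vector_space "\<lambda>c (f :: 'a list \<Rightarrow> 'm) xs. sM c (f xs)"
    by (rule vector_space_cochain_scale) (rule \<beta>.vs1.vector_space_axioms)
  show ?thesis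
    unfolding F.subspace_def hom_assoc_cochains_def multilinear_maps_def
    by (auto simp: \<beta>.add \<beta>.scale \<beta>.zero P.module_hom_zero P.linear_zero
        intro!: P.linear_compose_add P.linear_compose_scale_right)
qed


section \<open>Laplace expansion of the skew-symmetrization\<close>

definition omit :: "nat \<Rightarrow> 'a list \<Rightarrow> 'a list" where
  "omit i xs = take i xs @ drop (Suc i) xs"

definition insert_at :: "nat \<Rightarrow> 'a \<Rightarrow> 'a list \<Rightarrow> 'a list" where
  "insert_at p y ys = take p ys @ y # drop p ys"

lemma length_omit [simp]: "i < length xs \<Longrightarrow> length (omit i xs) = length xs - 1"
  by (simp add: omit_def)

lemma length_insert_at [simp]: "length (insert_at p y ys) = Suc (length ys)"
  by (simp add: insert_at_def)

text \<open>
  The reindexing \<open>insert_index i\<close> skips the value \<open>i\<close>, in the same convention as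
  \<open>permutation_insert\<close>, the extension of a permutation of \<open>n\<close> points by one prescribed value.
\<close>

lemma nth_omit: "i < length xs \<Longrightarrow> Suc k < length xs \<Longrightarrow> omit i xs ! k = xs ! insert_index i k"
  by (auto simp: omit_def nth_append insert_index_def)

lemma nth_insert_at:
  "p \<le> length ys \<Longrightarrow> k \<le> length ys \<Longrightarrow>
     insert_at p y ys ! k = (if k < p then ys ! k else if k = p then y else ys ! (k - 1))"
  by (auto simp: insert_at_def nth_append nth_Cons split: nat.split intro!: arg_cong[where f =
      "nth ys"])

lemma nths_delete_one:
  assumes "i < length xs"
  shows "nths xs (- {i}) = omit i xs"
proof -
  have "nths (take i xs @ xs ! i # drop (Suc i) xs) (- {i}) = take i xs @ drop (Suc i) xs"
  proof -
    have 1: "nths (take i xs) (- {i}) = take i xs"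
      by (rule nths_all) auto
    have 2: "nths (drop (Suc i) xs) UNIV = drop (Suc i) xs"
      by (rule nths_all) auto
    show ?thesis using assms 1 2 by (simp add: nths_append nths_Cons min_def)
  qed
  then show ?thesis using assms by (simp add: omit_def id_take_nth_drop[symmetric])
qed

text \<open>
  The larger position is removed first, so that the smaller one keeps its meaning.
\<close>

lemma nths_delete_two:
  assumes "i < j" "j < length xs"
  shows "nths xs (- {i, j}) = omit i (omit j xs)"
proof -
  let ?a = "take i xs" and ?b = "take (j - Suc i) (drop (Suc i) xs)" and ?c = "drop (Suc j) xs"
  have xs: "xs = ?a @ xs ! i # ?b @ xs ! j # ?c"
  proof -
    have "drop (Suc i) xs = ?b @ drop (j - Suc i) (drop (Suc i) xs)"
      by (rule append_take_drop_id[symmetric])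
    also have "drop (j - Suc i) (drop (Suc i) xs) = drop j xs" using assms by simp
    also have "\<dots> = xs ! j # ?c" using assms by (simp add: Cons_nth_drop_Suc)
    finally show ?thesis using assms by (metis id_take_nth_drop less_trans)
  qed
  have la: "length ?a = i" and lb: "length ?b = j - Suc i" using assms by auto
  have "nths (?a @ xs ! i # ?b @ xs ! j # ?c) (- {i, j}) = ?a @ ?b @ ?c"
  proof -
    have 1: "nths ?a (- {i, j}) = ?a" using assms by (intro nths_all) auto
    have 2: "nths ?b {k. Suc k + i \<in> - {i, j}} = ?b" using assms by (intro nths_all) auto
    have 3: "nths ?c {k. Suc (Suc (k + (j - Suc i) + i)) \<in> - {i, j}} = ?c"
      using assms by (intro nths_all) auto
    have "\<not> length xs - Suc i \<le> j - Suc i" using assms by linarith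
    then show ?thesis using assms 1 2 3
      by (simp add: nths_append nths_Cons la lb min_def)
  qed
  moreover have "omit i (omit j xs) = ?a @ ?b @ ?c"
    using assms by (simp add: omit_def min_def drop_take)
  ultimately show ?thesis using xs by metis
qed

text \<open>
  Permutations of \<open>n + 1\<close> points sending \<open>p\<close> to \<open>i\<close> correspond to permutations of \<open>n\<close> points. On
      lists
  the correspondence reads: set entry \<open>i\<close> aside, permute the others, and put it back at place \<open>p\<close>.
\<close>

lemma permute_list_permutation_insert:
  assumes q: "q permutes {..<n}" and xs: "length xs = Suc n" and p: "p \<le> n" and i: "i \<le> n"
  shows "permute_list (permutation_insert p i q) xs =
      insert_at p (xs ! i) (permute_list q (omit i xs))"
proof (rule nth_equalityI)
  fix k assume "k < length (permute_list (permutation_insert p i q) xs)"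
  then have k: "k \<le> n" using xs by simp
  have Q: "permutation_insert p i q permutes {..<Suc n}"
    using permutation_insert_permutes[of q n p i] q p i by (simp add: atLeast0LessThan)
  have lt: "m < n \<Longrightarrow> q m < n" for m using permutes_in_image[OF q] by auto
  have "permute_list (permutation_insert p i q) xs ! k = xs ! permutation_insert p i q k"
    using Q k xs by (simp add: permute_list_nth)
  also have "\<dots> = insert_at p (xs ! i) (permute_list q (omit i xs)) ! k"
    using k p i xs q lt[of k] lt[of "k - 1"]
    by (auto simp: nth_insert_at permute_list_nth nth_omit permutation_insert_def
        insert_dom_def insert_ran_def)
  finally show "permute_list (permutation_insert p i q) xs ! k =
      insert_at p (xs ! i) (permute_list q (omit i xs)) ! k" .
qed (use assms in auto)

context vector_space
begin

text \<open>
  The common part of row and column expansion: both group the permutations by the condition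
  \<open>\<sigma> p = i\<close>, one with \<open>p\<close> and the other with \<open>i\<close> held fixed.
\<close>

lemma skew_symmetrization_fixed_position:
  assumes xs: "length xs = Suc n" and p: "p \<le> n" and i: "i \<le> n"
  shows "(\<Sum>\<sigma> | \<sigma> permutes {..<Suc n} \<and> \<sigma> p = i. scale (of_int (sign \<sigma>)) (h (permute_list \<sigma> xs))) =
    scale ((-1) ^ (p + i)) (skew_symmetrization scale n (\<lambda>ys. h (insert_at p (xs ! i) ys)) (omit
        i xs))"
proof -
  have set: "{\<sigma>. \<sigma> permutes {..<Suc n} \<and> \<sigma> p = i} = permutation_insert p i ` {q. q permutes {..<n}}"
    using permutation_fix[of p n i] p i by (simp add: atLeast0LessThan)
  have inj: "inj_on (permutation_insert p i) {q. q permutes {..<n}}"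
    using permutation_insert_inj_on[of p n i] p i by (simp add: atLeast0LessThan)
  have sgn: "of_int (sign (permutation_insert p i q)) = (-1) ^ (p + i) * (of_int (sign q) :: 'a)"
    if "q permutes {..<n}" for q
    using signof_permutation_insert[of q n p i] that p i by (simp add: atLeast0LessThan)
  show ?thesis
    using xs i unfolding set
    by (simp add: sum.reindex[OF inj] skew_symmetrization_def scale_sum_right sgn
        permute_list_permutation_insert[OF _ xs p i])
qed

lemma skew_symmetrization_expand_row:
  assumes xs: "length xs = Suc n" and p: "p \<le> n"
  shows "skew_symmetrization scale (Suc n) h xs =
    (\<Sum>i<Suc n. scale ((-1) ^ (p + i))
       (skew_symmetrization scale n (\<lambda>ys. h (insert_at p (xs ! i) ys)) (omit i xs)))"
proof -
  let ?g = "\<lambda>\<sigma>. scale (of_int (sign \<sigma>)) (h (permute_list \<sigma> xs))"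
  have "skew_symmetrization scale (Suc n) h xs = sum ?g {\<sigma>. \<sigma> permutes {..<Suc n}}"
    using xs by (simp add: skew_symmetrization_def)
  also have "\<dots> = (\<Sum>i<Suc n. sum ?g {\<sigma> \<in> {\<sigma>. \<sigma> permutes {..<Suc n}}. \<sigma> p = i})"
  proof (rule sum.group[symmetric])
    show "(\<lambda>\<sigma>. \<sigma> p) ` {\<sigma>. \<sigma> permutes {..<Suc n}} \<subseteq> {..<Suc n}"
      using p by (auto dest!: permutes_in_image[where x = p])
  qed (auto simp: finite_permutations)
  also have "\<dots> = (\<Sum>i<Suc n. scale ((-1) ^ (p + i))
       (skew_symmetrization scale n (\<lambda>ys. h (insert_at p (xs ! i) ys)) (omit i xs)))"
    by (rule sum.cong)
      (simp_all add: skew_symmetrization_fixed_position[OF xs p] less_Suc_eq_le del: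
          sum.lessThan_Suc)
  finally show ?thesis .
qed

lemma skew_symmetrization_expand_column:
  assumes xs: "length xs = Suc n" and i: "i \<le> n"
  shows "skew_symmetrization scale (Suc n) h xs =
    (\<Sum>p<Suc n. scale ((-1) ^ (p + i))
       (skew_symmetrization scale n (\<lambda>ys. h (insert_at p (xs ! i) ys)) (omit i xs)))"
proof -
  let ?g = "\<lambda>\<sigma>. scale (of_int (sign \<sigma>)) (h (permute_list \<sigma> xs))"
  have "skew_symmetrization scale (Suc n) h xs = sum ?g {\<sigma>. \<sigma> permutes {..<Suc n}}"
    using xs by (simp add: skew_symmetrization_def)
  also have "\<dots> = (\<Sum>p<Suc n. sum ?g {\<sigma> \<in> {\<sigma>. \<sigma> permutes {..<Suc n}}. inv_into UNIV \<sigma> i = p})"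
  proof (rule sum.group[symmetric])
    show "(\<lambda>\<sigma>. inv_into UNIV \<sigma> i) ` {\<sigma>. \<sigma> permutes {..<Suc n}} \<subseteq> {..<Suc n}"
      using i permutes_in_image[OF permutes_inv, of _ "{..<Suc n}" i]
      by (intro image_subsetI) (simp only: mem_Collect_eq lessThan_iff less_Suc_eq_le)
  qed (auto simp: finite_permutations)
  also have "\<dots> = (\<Sum>p<Suc n. sum ?g {\<sigma>. \<sigma> permutes {..<Suc n} \<and> \<sigma> p = i})"
    by (intro sum.cong refl) (auto simp: permutes_inv_eq)
  also have "\<dots> = (\<Sum>p<Suc n. scale ((-1) ^ (p + i))
       (skew_symmetrization scale n (\<lambda>ys. h (insert_at p (xs ! i) ys)) (omit i xs)))"
    by (rule sum.cong)
      (simp_all add: skew_symmetrization_fixed_position[OF xs _ i] less_Suc_eq_le del: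
          sum.lessThan_Suc)
  finally show ?thesis .
qed

end


section \<open>Skew-symmetrization and alternating maps\<close>

lemma skew_symmetrization_cong:
  "(\<And>ys. length ys = n \<Longrightarrow> h ys = h' ys) \<Longrightarrow> skew_symmetrization sM n h xs =
      skew_symmetrization sM n h' xs"
  by (simp add: skew_symmetrization_def)

lemma skew_symmetrization_map:
  "skew_symmetrization sM n (\<lambda>ys. f (map g ys)) xs = skew_symmetrization sM n f (map g xs)"
  unfolding skew_symmetrization_def length_map
  by (intro if_cong sum.cong refl) (simp add: permute_list_map)

lemma skew_symmetrization_linear_image:
  assumes "Vector_Spaces.linear sM sM g"
  shows "skew_symmetrization sM n (\<lambda>ys. g (f ys)) xs = g (skew_symmetrization sM n f xs)"
proof -
  interpret g: Vector_Spaces.linear sM sM g by fact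
  show ?thesis by (simp add: skew_symmetrization_def g.sum g.scale g.zero)
qed

lemma skew_symmetrization_add:
  assumes "vector_space sM"
  shows "skew_symmetrization sM n (f + g) = skew_symmetrization sM n f + skew_symmetrization sM n g"
proof -
  interpret vector_space sM by fact
  show ?thesis by (auto simp: skew_symmetrization_def fun_eq_iff scale_right_distrib sum.distrib)
qed

lemma skew_symmetrization_scale:
  assumes "vector_space sM"
  shows "skew_symmetrization sM n (\<lambda>xs. sM c (f xs)) = (\<lambda>xs. sM c (skew_symmetrization sM n f xs))"
proof -
  interpret vector_space sM by fact
  show ?thesis by (auto simp: skew_symmetrization_def fun_eq_iff scale_sum_right mult.commute)
qed

lemma skew_symmetrization_sum:
  assumes "vector_space sM"
  shows "skew_symmetrization sM n (\<Sum>i\<in>I. F i) = (\<Sum>i\<in>I. skew_symmetrization sM n (F i))"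
proof -
  interpret vector_space sM by fact
  have "skew_symmetrization sM n 0 = 0"
    by (auto simp: skew_symmetrization_def fun_eq_iff)
  then show ?thesis
    by (induction I rule: infinite_finite_induct) (auto simp: skew_symmetrization_add[OF assms])
qed

text \<open>
  Left multiplication by \<open>\<tau>\<close> permutes the summands and multiplies the signs by the sign of \<open>\<tau>\<close>.
\<close>

lemma skew_symmetrization_permute:
  fixes sM :: "'k::field \<Rightarrow> 'm::ab_group_add \<Rightarrow> 'm"
  assumes "vector_space sM" and \<tau>: "\<tau> permutes {..<n}" and xs: "length xs = n"
  shows "skew_symmetrization sM n f (permute_list \<tau> xs) =
    sM (of_int (sign \<tau>)) (skew_symmetrization sM n f xs)"
proof -
  interpret vector_space sM by fact
  have "skew_symmetrization sM n f xs =
      (\<Sum>\<sigma> | \<sigma> permutes {..<n}. sM (of_int (sign (\<tau> \<circ> \<sigma>))) (f (permute_list (\<tau> \<circ> \<sigma>) xs)))"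
    unfolding skew_symmetrization_def if_P[OF xs] by (rule setum_permutations_compose_left[OF \<tau>])
  also have "\<dots> = (\<Sum>\<sigma> | \<sigma> permutes {..<n}.
      sM (of_int (sign \<tau>)) (sM (of_int (sign \<sigma>)) (f (permute_list \<sigma> (permute_list \<tau> xs)))))"
  proof (intro sum.cong refl)
    fix \<sigma> assume "\<sigma> \<in> {\<sigma>. \<sigma> permutes {..<n}}"
    then have \<sigma>: "\<sigma> permutes {..<n}" by simp
    have "sign (\<tau> \<circ> \<sigma>) = sign \<tau> * sign \<sigma>"
      using permutes_imp_permutation[OF finite_lessThan \<tau>] permutes_imp_permutation[OF
          finite_lessThan \<sigma>]
      by (rule sign_compose)
    moreover have "permute_list (\<tau> \<circ> \<sigma>) xs = permute_list \<sigma> (permute_list \<tau> xs)"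
      using \<sigma> xs by (intro permute_list_compose) simp
    ultimately show "sM (of_int (sign (\<tau> \<circ> \<sigma>))) (f (permute_list (\<tau> \<circ> \<sigma>) xs)) =
      sM (of_int (sign \<tau>)) (sM (of_int (sign \<sigma>)) (f (permute_list \<sigma> (permute_list \<tau> xs))))"
      by (simp only: of_int_mult scale_scale)
  qed
  also have "\<dots> = sM (of_int (sign \<tau>)) (skew_symmetrization sM n f (permute_list \<tau> xs))"
    using xs by (simp add: skew_symmetrization_def scale_sum_right)
  finally have "sM (of_int (sign \<tau>)) (skew_symmetrization sM n f xs) =
      sM (of_int (sign \<tau>) * of_int (sign \<tau>)) (skew_symmetrization sM n f (permute_list \<tau> xs))"
    by (simp only: scale_scale)
  also have "of_int (sign \<tau>) * of_int (sign \<tau>) = (1 :: 'k)"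
    by (simp flip: of_int_mult)
  finally show ?thesis by (simp only: scale_one)
qed

lemma permute_list_transpose:
  assumes "i < length xs" "j < length xs"
  shows "permute_list (transpose i j) xs = xs[i := xs ! j, j := xs ! i]"
  using assms by (auto intro!: nth_equalityI simp: permute_list_def nth_list_update transpose_def)

lemma permute_list_update:
  assumes "\<sigma> permutes {..<length xs}" "k < length xs"
  shows "permute_list \<sigma> (xs[k := a]) = (permute_list \<sigma> xs)[inv_into UNIV \<sigma> k := a]"
proof (rule nth_equalityI)
  fix m assume "m < length (permute_list \<sigma> (xs[k := a]))"
  then have m: "m < length xs" by simp
  moreover have "\<sigma> m < length xs" using permutes_in_image[OF assms(1), of m] m by simp
  moreover have "inv_into UNIV \<sigma> k = m \<longleftrightarrow> \<sigma> m = k"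
    using permutes_inv_eq[OF assms(1)] by metis
  ultimately show "permute_list \<sigma> (xs[k := a]) ! m =
      (permute_list \<sigma> xs)[inv_into UNIV \<sigma> k := a] ! m"
    using assms by (auto simp: permute_list_nth nth_list_update)
qed simp

text \<open>
  Exchanging two equal arguments changes the sign but not the list, so the value is its own
  negative; characteristic zero makes it vanish.
\<close>

lemma skew_symmetrization_alternating:
  fixes sM :: "'k::field_char_0 \<Rightarrow> 'm::ab_group_add \<Rightarrow> 'm"
  assumes A: "vector_space sA" and M: "vector_space sM" and f: "f \<in> multilinear_maps sA sM n"
  shows "skew_symmetrization sM n f \<in> alternating_maps sA sM n"
proof -
  interpret M: vector_space sM by fact
  interpret P: vector_space_pair sA sM using A M by (simp add: vector_space_pair_def)
  have "Vector_Spaces.linear sA sM (\<lambda>a. skew_symmetrization sM n f (xs[k := a]))"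
    if "length xs = n" "k < n" for xs k
  proof -
    have "Vector_Spaces.linear sA sM (\<lambda>a. \<Sum>\<sigma> | \<sigma> permutes {..<n}.
        sM (of_int (sign \<sigma>)) (f ((permute_list \<sigma> xs)[inv_into UNIV \<sigma> k := a])))"
      using that permutes_in_image[OF permutes_inv, of _ "{..<n}" k]
      by (intro P.linear_compose_sum ballI P.linear_compose_scale_right
          multilinear_maps_linear[OF f]) auto
    also have "(\<lambda>a. \<Sum>\<sigma> | \<sigma> permutes {..<n}.
        sM (of_int (sign \<sigma>)) (f ((permute_list \<sigma> xs)[inv_into UNIV \<sigma> k := a]))) =
        (\<lambda>a. skew_symmetrization sM n f (xs[k := a]))"
      using that by (auto simp: skew_symmetrization_def fun_eq_iff permute_list_update)
    finally show ?thesis .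
  qed
  moreover have "skew_symmetrization sM n f xs = 0"
    if xs: "length xs = n" and ij: "i < j" "j < n" "xs ! i = xs ! j" for xs i j
  proof -
    let ?S = "skew_symmetrization sM n f xs"
    have "permute_list (transpose i j) xs = xs"
      using xs ij by (simp add: permute_list_transpose flip: ij(3)) (metis ij(3) list_update_id)
    moreover have "transpose i j permutes {..<n}"
      using ij by (intro permutes_swap_id) auto
    ultimately have "?S = sM (of_int (sign (transpose i j))) ?S"
      using skew_symmetrization_permute[OF M _ xs, of "transpose i j" f] by metis
    also have "\<dots> = - ?S" using ij by (simp add: sign_swap_id)
    finally have "?S + ?S = 0" by (simp only: eq_neg_iff_add_eq_0)
    then have "sM (1 + 1) ?S = 0" by (simp only: M.scale_left_distrib M.scale_one)
    then show ?thesis by simp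
  qed
  ultimately show ?thesis
    by (simp add: alternating_maps_def multilinear_maps_def skew_symmetrization_def)
qed

text \<open>
  Polarization: expand the zero obtained by putting the sum of the two entries into both places.
\<close>

lemma alternating_maps_transpose:
  assumes f: "f \<in> alternating_maps sA sM n" and xs: "length xs = n" and ij: "i < n" "j < n" "i \<noteq> j"
  shows "f (permute_list (transpose i j) xs) = - f xs"
proof -
  have fm: "f \<in> multilinear_maps sA sM n" using f by (simp add: alternating_maps_def)
  have alt: "f (xs[i := a, j := a]) = 0" for a
  proof -
    have "f ys = 0" if "length ys = n" "p < q" "q < n" "ys ! p = ys ! q" for ys p q
      using f that by (simp add: alternating_maps_def)
    from this[of "xs[i := a, j := a]" i j] this[of "xs[i := a, j := a]" j i]
    show ?thesis using xs ij by (cases "i < j") (simp_all add: nth_list_update)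
  qed
  have add1: "f (xs[i := a + b, j := c]) = f (xs[i := a, j := c]) + f (xs[i := b, j := c])"
      for a b c
  proof -
    interpret Vector_Spaces.linear sA sM "\<lambda>a. f (xs[j := c, i := a])"
      by (rule multilinear_maps_linear[OF fm]) (use xs ij in auto)
    show ?thesis using add[of a b] ij by (simp add: list_update_swap)
  qed
  have add2: "f (xs[i := c, j := a + b]) = f (xs[i := c, j := a]) + f (xs[i := c, j := b])"
      for a b c
  proof -
    interpret Vector_Spaces.linear sA sM "\<lambda>a. f (xs[i := c, j := a])"
      by (rule multilinear_maps_linear[OF fm]) (use xs ij in auto)
    show ?thesis using add[of a b] .
  qed
  let ?u = "xs ! i" and ?v = "xs ! j"
  have "0 = f (xs[i := ?u + ?v, j := ?u + ?v])" by (simp only: alt)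
  also have "\<dots> = f (xs[i := ?u, j := ?v]) + f (xs[i := ?v, j := ?u])"
    unfolding add1 add2 by (simp only: alt add_0_left add_0_right add.commute)
  finally have "f (xs[i := ?u, j := ?v]) + f (xs[i := ?v, j := ?u]) = 0" by simp
  then show ?thesis
    using xs ij by (simp add: permute_list_transpose eq_neg_iff_add_eq_0 add.commute)
qed

lemma alternating_maps_permute:
  fixes sM :: "'k::field \<Rightarrow> 'm::ab_group_add \<Rightarrow> 'm"
  assumes M: "vector_space sM" and f: "f \<in> alternating_maps sA sM n"
    and \<sigma>: "\<sigma> permutes {..<n}" and xs: "length xs = n"
  shows "f (permute_list \<sigma> xs) = sM (of_int (sign \<sigma>)) (f xs)"
  using \<sigma> finite_lessThan xs
proof (induction \<sigma> arbitrary: xs rule: permutes_induct)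
  case id
  interpret vector_space sM by fact
  show ?case by simp
next
  case (swap a b p)
  interpret vector_space sM by fact
  have "f (permute_list (transpose a b \<circ> p) xs) =
      f (permute_list p (permute_list (transpose a b) xs))"
    using swap by (simp add: permute_list_compose)
  also have "\<dots> = sM (of_int (sign p)) (- f xs)"
    using swap f by (simp add: alternating_maps_transpose)
  also have "\<dots> = sM (of_int (sign (transpose a b \<circ> p))) (f xs)"
    using swap permutes_imp_permutation[of "{..<n}" p]
    by (simp add: sign_compose permutation_swap_id sign_swap_id)
  finally show ?case .
qed

text \<open>
  All \<open>n!\<close> summands agree, because the sign from the definition cancels the one from alternation.
\<close>

lemma skew_symmetrization_of_alternating:
  fixes sM :: "'k::field_char_0 \<Rightarrow> 'm::ab_group_add \<Rightarrow> 'm"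
  assumes M: "vector_space sM" and f: "f \<in> alternating_maps sA sM n"
  shows "skew_symmetrization sM n f = (\<lambda>xs. sM (fact n) (f xs))"
proof
  fix xs
  interpret M: vector_space sM by fact
  show "skew_symmetrization sM n f xs = sM (fact n) (f xs)"
  proof (cases "length xs = n")
    case True
    have sq: "of_int (sign \<sigma>) * of_int (sign \<sigma>) = (1 :: 'k)" for \<sigma> :: "nat \<Rightarrow> nat"
      by (simp flip: of_int_mult)
    have "skew_symmetrization sM n f xs = (\<Sum>\<sigma> | \<sigma> permutes {..<n}. f xs)"
      using True by (simp add: skew_symmetrization_def alternating_maps_permute[OF M f] sq)
    also have "\<dots> = sM (of_nat (card {\<sigma>. \<sigma> permutes {..<n}})) (f xs)"
      by (simp add: M.sum_constant_scale)
    also have "card {\<sigma>. \<sigma> permutes {..<n}} = fact n"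
      by (rule card_permutations) auto
    finally show ?thesis by simp
  next
    case False
    then show ?thesis
      using f by (simp add: skew_symmetrization_def alternating_maps_def multilinear_maps_def)
  qed
qed

text \<open>
  A preimage of an alternating cochain \<open>g\<close> is \<open>g / n!\<close>.
\<close>

lemma skew_symmetrization_cochains_onto:
  fixes sA :: "'k::field_char_0 \<Rightarrow> 'a::ab_group_add \<Rightarrow> 'a" and sM :: "'k \<Rightarrow> 'm::ab_group_add \<Rightarrow> 'm"
  assumes A: "vector_space sA" and \<beta>: "Vector_Spaces.linear sM sM \<beta>"
  shows "skew_symmetrization sM n ` hom_assoc_cochains sA sM \<alpha> \<beta> n = hom_lie_cochains sA sM \<alpha> \<beta> n"
proof (intro equalityI subsetI)
  interpret \<beta>: Vector_Spaces.linear sM sM \<beta> by fact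
  note M = \<beta>.vs1.vector_space_axioms
  interpret F: vector_space "\<lambda>c (f :: 'a list \<Rightarrow> 'm) xs. sM c (f xs)"
    by (rule vector_space_cochain_scale) (rule M)
  fix g
  {
    assume "g \<in> skew_symmetrization sM n ` hom_assoc_cochains sA sM \<alpha> \<beta> n"
    then obtain f where f: "f \<in> multilinear_maps sA sM n"
      "\<And>xs. length xs = n \<Longrightarrow> \<beta> (f xs) = f (map \<alpha> xs)" and g: "g = skew_symmetrization sM n f"
      by (auto simp: hom_assoc_cochains_def)
    have "g (map \<alpha> xs) = \<beta> (g xs)" for xs
    proof -
      have "g (map \<alpha> xs) = skew_symmetrization sM n (\<lambda>ys. f (map \<alpha> ys)) xs"
        by (simp add: g skew_symmetrization_map)
      also have "\<dots> = skew_symmetrization sM n (\<lambda>ys. \<beta> (f ys)) xs"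
        by (rule skew_symmetrization_cong) (simp add: f)
      finally show ?thesis by (simp add: g skew_symmetrization_linear_image[OF \<beta>])
    qed
    then show "g \<in> hom_lie_cochains sA sM \<alpha> \<beta> n"
      using skew_symmetrization_alternating[OF A M f(1)] by (simp add: hom_lie_cochains_def g)
  }
  {
    assume g: "g \<in> hom_lie_cochains sA sM \<alpha> \<beta> n"
    let ?f = "\<lambda>xs. sM (1 / fact n) (g xs)"
    have "g \<in> hom_assoc_cochains sA sM \<alpha> \<beta> n"
      using g by (simp add: hom_lie_cochains_def hom_assoc_cochains_def alternating_maps_def)
    then have "?f \<in> hom_assoc_cochains sA sM \<alpha> \<beta> n"
      by (rule F.subspace_scale[OF subspace_hom_assoc_cochains[OF A \<beta>]])
    moreover have "skew_symmetrization sM n ?f = g"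
      using g skew_symmetrization_of_alternating[OF M, of g sA n]
      by (simp add: skew_symmetrization_scale[OF M] hom_lie_cochains_def)
    ultimately show "g \<in> skew_symmetrization sM n ` hom_assoc_cochains sA sM \<alpha> \<beta> n"
      by force
  }
qed


section \<open>The Hom-associative differential of a bimodule\<close>

text \<open>
  One step of a coface on the arguments: two neighbours are multiplied
      and all other entries twisted,
  as in the inner summands of the Hom-associative differential.
\<close>

definition merge :: "('a \<Rightarrow> 'a \<Rightarrow> 'a) \<Rightarrow> ('a \<Rightarrow> 'a) \<Rightarrow> nat \<Rightarrow> 'a list \<Rightarrow> 'a list" where
  "merge \<mu> \<alpha> i xs = map \<alpha> (take i xs) @ [\<mu> (xs ! i) (xs ! (i + 1))] @ map \<alpha> (drop (i + 2) xs)"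

lemma merge_0 [simp]: "merge \<mu> \<alpha> 0 (a # b # xs) = \<mu> a b # map \<alpha> xs"
  and merge_Suc [simp]: "merge \<mu> \<alpha> (Suc i) (a # xs) = \<alpha> a # merge \<mu> \<alpha> i xs"
  by (simp_all add: merge_def)

lemma length_merge [simp]: "Suc i < length xs \<Longrightarrow> length (merge \<mu> \<alpha> i xs) = length xs - 1"
  by (simp add: merge_def)

lemma merge_append_single:
  "Suc i < length xs \<Longrightarrow> merge \<mu> \<alpha> i (xs @ [a]) = merge \<mu> \<alpha> i xs @ [\<alpha> a]"
  by (simp add: merge_def nth_append)

lemma merge_last_two: "merge \<mu> \<alpha> (length xs) (xs @ [a, b]) = map \<alpha> xs @ [\<mu> a b]"
  by (simp add: merge_def nth_append)

lemma merge_update: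
  assumes "Suc i < length xs" "k < length xs"
  shows "merge \<mu> \<alpha> i (xs[k := a]) =
    (if k < i then (merge \<mu> \<alpha> i xs)[k := \<alpha> a]
     else if k = i then (merge \<mu> \<alpha> i xs)[i := \<mu> a (xs ! Suc i)]
     else if k = Suc i then (merge \<mu> \<alpha> i xs)[i := \<mu> (xs ! i) a]
     else (merge \<mu> \<alpha> i xs)[k - 1 := \<alpha> a])"
  using assms
proof (induction i arbitrary: xs k)
  case 0
  then obtain b c ys where xs: "xs = b # c # ys"
    by (cases xs; cases "tl xs") auto
  then show ?case
    by (cases k; cases "k - 1") (auto simp: map_update)
next
  case (Suc i)
  then obtain b ys where xs: "xs = b # ys" by (cases xs) auto
  show ?case
  proof (cases k)
    case (Suc k')
    then show ?thesis using Suc.IH[of ys k'] Suc.prems xs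
      by (cases k') auto
  qed (simp add: xs)
qed

context hom_assoc_algebra
begin

lemma merge_map_twist: "merge \<mu> \<alpha> i (map \<alpha> xs) = map \<alpha> (merge \<mu> \<alpha> i xs)" if "Suc i < length xs"
  using that by (simp add: merge_def twist_mult take_map drop_map)

text \<open>
  Overlapping products are equal by Hom-associativity, disjoint ones because the twist is
  multiplicative.
\<close>

lemma merge_merge:
  assumes "i \<le> j" "Suc (Suc j) < length xs"
  shows "merge \<mu> \<alpha> i (merge \<mu> \<alpha> (Suc j) xs) = merge \<mu> \<alpha> j (merge \<mu> \<alpha> i xs)"
  using assms
proof (induction i arbitrary: j xs)
  case 0
  then obtain a b c ys where xs: "xs = a # b # c # ys"
    by (cases xs; cases "tl xs"; cases "tl (tl xs)") auto
  then show ?case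
    using 0 merge_map_twist[of "j - 1" "c # ys"] by (cases j) (auto simp: hom_assoc twist_mult)
next
  case (Suc i)
  then obtain a ys j' where xs: "xs = a # ys" "j = Suc j'" by (cases xs; cases j) auto
  then show ?case using Suc by simp
qed

lemma funpow_twist_mult: "(\<alpha> ^^ k) (\<mu> a b) = \<mu> ((\<alpha> ^^ k) a) ((\<alpha> ^^ k) b)"
  by (induction k) (auto simp: twist_mult)

lemma linear_funpow_twist: "Vector_Spaces.linear sA sA (\<alpha> ^^ k)"
proof (induction k)
  case 0
  interpret Vector_Spaces.linear sA sA \<alpha> by (rule linear_twist)
  show ?case using vs1.linear_id by (simp add: id_def)
next
  case (Suc k)
  then show ?case using Vector_Spaces.linear_compose[OF Suc linear_twist] by (simp add: o_def)
qed

end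

text \<open>
  Twisted versions of the cofaces of the Hochschild complex. Index \<open>0\<close> is the left action
      and \<open>n + 1\<close>
  the right action; index \<open>i\<close> in between multiplies the neighbours at positions \<open>i - 1\<close> and \<open>i\<close>.
\<close>

definition coface ::
  "('a \<Rightarrow> 'a \<Rightarrow> 'a) \<Rightarrow> ('a \<Rightarrow> 'a) \<Rightarrow> ('a \<Rightarrow> 'm \<Rightarrow> 'm) \<Rightarrow> ('m \<Rightarrow> 'a \<Rightarrow> 'm) \<Rightarrow>
   nat \<Rightarrow> nat \<Rightarrow> ('a list \<Rightarrow> 'm::zero) \<Rightarrow> 'a list \<Rightarrow> 'm" where
  "coface \<mu> \<alpha> l r n i f xs =
     (if length xs \<noteq> Suc n then 0
      else if i = 0 then l ((\<alpha> ^^ (n - 1)) (hd xs)) (f (tl xs))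
      else if i = Suc n then r (f (butlast xs)) ((\<alpha> ^^ (n - 1)) (last xs))
      else f (merge \<mu> \<alpha> (i - 1) xs))"

lemma hom_assoc_differential_eq_coface_sum:
  assumes "vector_space sM"
  shows "hom_assoc_differential sM \<mu> \<alpha> l r n f =
    (\<Sum>i<Suc (Suc n). (\<lambda>xs. sM ((-1) ^ i) (coface \<mu> \<alpha> l r n i f xs)))"
proof
  interpret M: vector_space sM by fact
  fix xs
  show "hom_assoc_differential sM \<mu> \<alpha> l r n f xs =
    (\<Sum>i<Suc (Suc n). (\<lambda>xs. sM ((-1) ^ i) (coface \<mu> \<alpha> l r n i f xs))) xs"
    unfolding sum_fun_apply
    by (subst sum.lessThan_Suc, subst sum.lessThan_Suc_shift)
       (simp add: hom_assoc_differential_def coface_def merge_def)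
qed

text \<open>
  The terms with \<open>i < j\<close> cancel against the others under \<open>(j, i) \<mapsto> (i, j - 1)\<close>, which flips the
      sign.
\<close>

lemma (in vector_space) alternating_double_sum_cancels:
  assumes "\<And>i j. i < j \<Longrightarrow> j \<le> Suc N \<Longrightarrow> T j i = T i (j - 1)"
  shows "(\<Sum>j<Suc (Suc N). \<Sum>i<Suc N. scale ((-1) ^ (j + i)) (T j i)) = 0"
proof -
  let ?S = "{..<Suc (Suc N)} \<times> {..<Suc N}"
  let ?t = "\<lambda>(j, i). scale ((-1) ^ (j + i)) (T j i)"
  let ?L = "{(j, i) \<in> ?S. i < j}" and ?U = "{(j, i) \<in> ?S. j \<le> i}"
  have "(\<Sum>j<Suc (Suc N). \<Sum>i<Suc N. scale ((-1) ^ (j + i)) (T j i)) = sum ?t ?S"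
    by (simp only: sum.cartesian_product)
  also have "?S = ?L \<union> ?U" by auto
  also have "sum ?t (?L \<union> ?U) = sum ?t ?L + sum ?t ?U"
    by (rule sum.union_disjoint) (auto intro: finite_subset[of _ ?S])
  also have "sum ?t ?L = sum (\<lambda>p. - ?t p) ?U"
  proof (rule sum.reindex_bij_witness[where i = "\<lambda>(j, i). (Suc i, j)" and j =
      "\<lambda>(j, i). (i, j - 1)"])
    fix p assume "p \<in> ?L"
    then obtain i j where p: "p = (Suc j, i)" "i \<le> j" "j \<le> N"
      by (cases p; cases "fst p") auto
    have "T (Suc j) i = T i j" using assms[of i "Suc j"] p by simp
    then show "- ?t ((\<lambda>(j, i). (i, j - 1)) p) = ?t p"
      by (simp add: p add.commute)
  qed auto
  finally show ?thesis by (simp add: sum_negf)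
qed

context hom_bimodule
begin

lemma vector_space_module: "vector_space sM"
  using linear_mod_twist by (simp add: Vector_Spaces.linear_iff)

lemma vector_space_algebra: "vector_space sA"
  using linear_twist by (simp add: Vector_Spaces.linear_iff)

lemma left_linear: "Vector_Spaces.linear sM sM (l a)" "Vector_Spaces.linear sA sM (\<lambda>a. l a m)"
  using bilinear_left by (auto simp: bilinear_map_def)

lemma right_linear: "Vector_Spaces.linear sA sM (r m)" "Vector_Spaces.linear sM sM (\<lambda>m. r m a)"
  using bilinear_right by (auto simp: bilinear_map_def)

lemma mult_linear: "Vector_Spaces.linear sA sA (\<mu> a)" "Vector_Spaces.linear sA sA (\<lambda>a. \<mu> a b)"
  using bilinear_mult by (auto simp: bilinear_map_def)

text \<open>
  The cosimplicial identities. At the two ends (\<open>i = 0, j = 1\<close> and \<open>i = n + 1, j = n +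
      2\<close>) they are the
  module axioms containing \<open>\<beta>\<close>, and the equivariance of \<open>f\<close> supplies that \<open>\<beta>\<close>; the extreme pair
  \<open>i = 0, j = n + 2\<close> is the commutation of the two actions.
\<close>

lemma coface_coface:
  assumes f: "f \<in> hom_assoc_cochains sA sM \<alpha> \<beta> n" and n: "n \<ge> 1" and ij: "i < j" "j \<le> Suc (Suc n)"
  shows "coface \<mu> \<alpha> l r (Suc n) j (coface \<mu> \<alpha> l r n i f) =
    coface \<mu> \<alpha> l r (Suc n) i (coface \<mu> \<alpha> l r n (j - 1) f)"
proof
  fix xs
  show "coface \<mu> \<alpha> l r (Suc n) j (coface \<mu> \<alpha> l r n i f) xs =
    coface \<mu> \<alpha> l r (Suc n) i (coface \<mu> \<alpha> l r n (j - 1) f) xs"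
  proof (cases "length xs = Suc (Suc n)")
    case len: True
    have equiv: "\<beta> (f ys) = f (map \<alpha> ys)" if "length ys = n" for ys
      using f that by (simp add: hom_assoc_cochains_def)
    have pow: "(\<alpha> ^^ n) a = \<alpha> ((\<alpha> ^^ (n - Suc 0)) a)"
      "(\<alpha> ^^ (n - Suc 0)) (\<alpha> a) = \<alpha> ((\<alpha> ^^ (n - Suc 0)) a)" for a
      using n by (cases n; simp add: funpow_swap1)+
    obtain j' where j: "j = Suc j'" using ij by (cases j) auto
    obtain a b ys where xs: "xs = a # b # ys" and ys: "length ys = n"
      using len by (cases xs; cases "tl xs") auto
    \<comment> \<open>The identities near the left end see the first two entries, those near the right end the
        last two.\<close>
    obtain zs c d where xs': "xs = zs @ [c, d]" and zs: "length zs = n"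
      using len by (cases xs rule: rev_cases; cases "butlast xs" rule: rev_cases) auto
    consider (first) "i = 0" "j = 1" | (left) "i = 0" "1 < j" "j < Suc (Suc n)"
      | (outer) "i = 0" "j = Suc (Suc n)" | (inner) "0 < i" "j < Suc (Suc n)"
      | (right) "0 < i" "i \<le> n" "j = Suc (Suc n)" | (last) "i = Suc n" "j = Suc (Suc n)"
      using ij by linarith
    then show ?thesis
    proof cases
      case first
      then show ?thesis using n ys
        by (simp add: coface_def xs funpow_twist_mult pow left_left[symmetric] equiv)
    next
      case left
      then obtain k where "j = Suc (Suc k)" by (cases j; cases "j - 1") auto
      then show ?thesis using left n ys
        by (simp add: coface_def xs pow)
    next
      case outer
      then show ?thesis using n ys zs
        by (cases ys rule: rev_cases) (simp_all add: coface_def xs pow left_right)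
    next
      case inner
      then obtain i' where i: "i = Suc i'" by (cases i) auto
      obtain k where k: "j = Suc (Suc k)" using inner ij by (cases j; cases "j - 1") auto
      show ?thesis using inner n ij len merge_merge[of i' k xs]
        by (simp add: coface_def i k)
    next
      case right
      then obtain i' where i: "i = Suc i'" by (cases i) auto
      have "merge \<mu> \<alpha> i' ((zs @ [c]) @ [d]) = merge \<mu> \<alpha> i' (zs @ [c]) @ [\<alpha> d]"
        by (rule merge_append_single) (use right zs i in simp)
      then show ?thesis using right n zs
        by (simp add: coface_def i xs' pow butlast_append)
    next
      case last
      have "merge \<mu> \<alpha> n (zs @ [c, d]) = map \<alpha> zs @ [\<mu> c d]"
        using merge_last_two[of \<mu> \<alpha> zs c d] zs by simp
      then show ?thesis using last n zs
        by (simp add: coface_def xs' pow butlast_append funpow_twist_mult right_right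
            equiv[symmetric])
    qed
  qed (simp add: coface_def)
qed

lemma coface_sum:
  "coface \<mu> \<alpha> l r n j (\<Sum>i\<in>I. (\<lambda>xs. sM (c i) (F i xs))) xs =
      (\<Sum>i\<in>I. sM (c i) (coface \<mu> \<alpha> l r n j (F i) xs))"
proof -
  interpret M: vector_space sM by (rule vector_space_module)
  interpret L: Vector_Spaces.linear sM sM "l a" for a by (rule left_linear)
  interpret R: Vector_Spaces.linear sM sM "\<lambda>m. r m a" for a by (rule right_linear)
  show ?thesis
    by (simp add: coface_def sum_fun_apply L.sum L.scale R.sum R.scale)
qed

lemma hom_assoc_differential_square:
  assumes f: "f \<in> hom_assoc_cochains sA sM \<alpha> \<beta> n" and n: "n \<ge> 1"
  shows "hom_assoc_differential sM \<mu> \<alpha> l r (Suc n) (hom_assoc_differential sM \<mu> \<alpha> l r n f) = 0"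
proof
  fix xs
  interpret M: vector_space sM by (rule vector_space_module)
  let ?T = "\<lambda>j i. coface \<mu> \<alpha> l r (Suc n) j (coface \<mu> \<alpha> l r n i f) xs"
  have "hom_assoc_differential sM \<mu> \<alpha> l r (Suc n) (hom_assoc_differential sM \<mu> \<alpha> l r n f) xs
    = (\<Sum>j<Suc (Suc (Suc n)). \<Sum>i<Suc (Suc n). sM ((-1) ^ (j + i)) (?T j i))"
    unfolding hom_assoc_differential_eq_coface_sum[OF vector_space_module] sum_fun_apply coface_sum
    by (simp only: M.scale_sum_right M.scale_scale power_add)
  also have "\<dots> = 0"
    by (rule M.alternating_double_sum_cancels) (simp add: coface_coface[OF f n])
  finally show "hom_assoc_differential sM \<mu> \<alpha> l r (Suc n) (hom_assoc_differential sM \<mu> \<alpha> l r n f) xs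
    = 0 xs" by simp
qed

lemma coface_cochain:
  assumes f: "f \<in> hom_assoc_cochains sA sM \<alpha> \<beta> n" and n: "n \<ge> 1" and i: "i \<le> Suc n"
  shows "coface \<mu> \<alpha> l r n i f \<in> hom_assoc_cochains sA sM \<alpha> \<beta> (Suc n)"
proof -
  let ?D = "coface \<mu> \<alpha> l r n i f"
  have fm: "f \<in> multilinear_maps sA sM n" using f by (simp add: hom_assoc_cochains_def)
  have equiv: "\<beta> (f ys) = f (map \<alpha> ys)" if "length ys = n" for ys
    using f that by (simp add: hom_assoc_cochains_def)
  have lin: "Vector_Spaces.linear sA sM (\<lambda>a. f (ys[k := a]))" if "length ys = n" "k < n" for ys k
    by (rule multilinear_maps_linear[OF fm that])
  have "Vector_Spaces.linear sA sM (\<lambda>a. ?D (xs[k := a]))" if xs: "length xs = Suc n" and k: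
      "k < Suc n" for xs k
  proof -
    consider (first) "i = 0" | (last) "i = Suc n" | (inner) i' where "i = Suc i'" "i' < n"
      using i by (cases i) force+
    then show ?thesis
    proof cases
      case first
      obtain b ys where b: "xs = b # ys" "length ys = n" using xs by (cases xs) auto
      show ?thesis
      proof (cases k)
        case 0
        show ?thesis
          using linear_compose_fun[OF linear_funpow_twist left_linear(2)]
              by (simp add: coface_def first b 0)
      next
        case (Suc k')
        show ?thesis
          using linear_compose_fun[OF lin[OF b(2)] left_linear(1)] k
              by (simp add: coface_def first b Suc)
      qed
    next
      case last
      obtain b ys where b: "xs = ys @ [b]" "length ys = n" using xs
          by (cases xs rule: rev_cases) auto
      show ?thesis
      proof (cases "k = n")
        case True
        show ?thesis
          using linear_compose_fun[OF linear_funpow_twist right_linear(1)]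
          by (simp add: coface_def last b True list_update_append)
      next
        case False
        show ?thesis
          using linear_compose_fun[OF lin[OF b(2)] right_linear(2)] k False
          by (simp add: coface_def last b list_update_append)
      qed
    next
      case inner
      have len: "length (merge \<mu> \<alpha> i' xs) = n" using inner xs by simp
      have D: "?D (xs[k := a]) = f (merge \<mu> \<alpha> i' (xs[k := a]))" for a
        using inner xs by (simp add: coface_def)
      note lin = linear_compose_fun[OF _ lin[OF len]]
      consider "k < i'" | "k = i'" | "k = Suc i'" | "Suc i' < k" by linarith
      then show ?thesis
        unfolding D using inner xs k
        by cases (simp_all add: merge_update lin[OF linear_twist] lin[OF mult_linear(1)]
            lin[OF mult_linear(2)])
    qed
  qed
  moreover have "\<beta> (?D xs) = ?D (map \<alpha> xs)" if xs: "length xs = Suc n" for xs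
    using xs i n hd_map[of xs \<alpha>] last_map[of xs \<alpha>]
    by (cases "xs = []") (auto simp: coface_def equiv twist_left twist_right map_tl map_butlast
        merge_map_twist funpow_swap1 simp flip: map_tl map_butlast)
  ultimately show ?thesis
    by (simp add: hom_assoc_cochains_def multilinear_maps_def coface_def)
qed

lemma hom_assoc_differential_cochain:
  assumes f: "f \<in> hom_assoc_cochains sA sM \<alpha> \<beta> n" and n: "n \<ge> 1"
  shows "hom_assoc_differential sM \<mu> \<alpha> l r n f \<in> hom_assoc_cochains sA sM \<alpha> \<beta> (Suc n)"
proof -
  interpret F: vector_space "\<lambda>c (f :: 'b list \<Rightarrow> 'm) xs. sM c (f xs)"
    by (rule vector_space_cochain_scale) (rule vector_space_module)
  have sub: "F.subspace (hom_assoc_cochains sA sM \<alpha> \<beta> (Suc n))"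
    by (rule subspace_hom_assoc_cochains) (rule vector_space_algebra linear_mod_twist)+
  show ?thesis
    unfolding hom_assoc_differential_eq_coface_sum[OF vector_space_module]
    by (rule F.subspace_sum[OF sub], rule F.subspace_scale[OF sub], rule coface_cochain[OF f n])
        simp
qed

lemma hom_assoc_differential_add:
  "hom_assoc_differential sM \<mu> \<alpha> l r n (f + g) =
   hom_assoc_differential sM \<mu> \<alpha> l r n f + hom_assoc_differential sM \<mu> \<alpha> l r n g"
  and hom_assoc_differential_scale:
  "hom_assoc_differential sM \<mu> \<alpha> l r n (\<lambda>xs. sM c (f xs)) =
   (\<lambda>xs. sM c (hom_assoc_differential sM \<mu> \<alpha> l r n f xs))"
proof -
  interpret M: vector_space sM by (rule vector_space_module)
  interpret L: Vector_Spaces.linear sM sM "l a" for a by (rule left_linear)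
  interpret R: Vector_Spaces.linear sM sM "\<lambda>m. r m a" for a by (rule right_linear)
  show "hom_assoc_differential sM \<mu> \<alpha> l r n (f + g) =
   hom_assoc_differential sM \<mu> \<alpha> l r n f + hom_assoc_differential sM \<mu> \<alpha> l r n g"
    by (auto simp: hom_assoc_differential_def fun_eq_iff L.add R.add M.scale_right_distrib
        sum.distrib
        sum_negf sum_subtractf algebra_simps)
  show "hom_assoc_differential sM \<mu> \<alpha> l r n (\<lambda>xs. sM c (f xs)) =
   (\<lambda>xs. sM c (hom_assoc_differential sM \<mu> \<alpha> l r n f xs))"
    by (auto simp: hom_assoc_differential_def fun_eq_iff L.scale R.scale M.scale_right_distrib
        M.scale_right_diff_distrib M.scale_sum_right mult.commute)
qed

end


section \<open>Skew-symmetrization intertwines the differentials\<close>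

text \<open>
  Removing the entry \<open>i\<close> and then the entry \<open>j\<close> of the remaining list chooses an ordered pair of
  positions. If the second position lies to the right of the first, its index has dropped
      by one, and
  this shift is the relative sign between the two orders of a pair.
\<close>

lemma (in vector_space) sum_over_ordered_pairs:
  assumes xs: "length xs = Suc (Suc m)"
  shows "(\<Sum>i<Suc (Suc m). \<Sum>j<Suc m. scale ((-1) ^ (i +
      j)) (G (xs ! i) (omit i xs ! j) (omit j (omit i xs))))
    = - (\<Sum>j<Suc (Suc m). \<Sum>i<j. scale ((-1) ^ (i + j))
          (G (xs ! i) (xs ! j) (nths xs (- {i, j})) - G (xs ! j) (xs ! i) (nths xs (- {i, j}))))"
proof -
  let ?n = "Suc (Suc m)"
  let ?t = "\<lambda>i j. scale ((-1) ^ (i + j)) (G (xs ! i) (omit i xs ! j) (omit j (omit i xs)))"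
  have split: "(\<Sum>j<Suc m. ?t i j) = (\<Sum>j<i. ?t i j) + (\<Sum>j=Suc i..<?n. ?t i (j - 1))" if "i < ?n"
      for i
  proof -
    have "(\<Sum>j<Suc m. ?t i j) = (\<Sum>j<i. ?t i j) + (\<Sum>j=i..<Suc m. ?t i j)"
      using that by (simp only: lessThan_atLeast0) (rule sum.atLeastLessThan_concat[symmetric];
          simp)
    also have "(\<Sum>j=i..<Suc m. ?t i j) = (\<Sum>j=Suc i..<?n. ?t i (j - 1))"
      by (subst sum.shift_bounds_Suc_ivl) simp
    finally show ?thesis .
  qed
  have low: "?t i j = scale ((-1) ^ (i + j)) (G (xs ! i) (xs ! j) (nths xs (- {j, i})))" if
      "j < i" "i < ?n" for i j
    using that xs nths_delete_two[of j i xs] by (simp add: nth_omit)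
  have high: "?t i (j - 1) = - scale ((-1) ^ (i + j)) (G (xs ! i) (xs ! j) (nths xs (- {i, j})))"
    if "i < j" "j < ?n" for i j
  proof -
    have "omit (j - 1) (omit i xs) = omit i (omit j xs)"
      using that xs by (intro nth_equalityI) (auto simp: nth_omit insert_index_def)
    moreover have "omit i xs ! (j - 1) = xs ! j"
      using that xs by (cases j) (simp_all add: nth_omit insert_index_def)
    moreover have "(-1) ^ (i + (j - 1)) = (- ((-1) ^ (i + j)) :: 'a)"
      using that by (cases j) auto
    ultimately show ?thesis using that xs by (simp add: nths_delete_two)
  qed
  have "(\<Sum>i<?n. \<Sum>j<Suc m. ?t i j) =
    (\<Sum>i<?n. \<Sum>j<i. ?t i j) + (\<Sum>i<?n. \<Sum>j=Suc i..<?n. ?t i (j - 1))"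
    by (simp add: split sum.distrib del: sum.lessThan_Suc sum.op_ivl_Suc)
  also have "(\<Sum>i<?n. \<Sum>j<i. ?t i j) =
    (\<Sum>j<?n. \<Sum>i<j. scale ((-1) ^ (i + j)) (G (xs ! j) (xs ! i) (nths xs (- {i, j}))))"
    by (intro sum.cong refl) (simp add: low add.commute)
  also have "(\<Sum>i<?n. \<Sum>j=Suc i..<?n. ?t i (j - 1)) =
    (\<Sum>i<?n. \<Sum>j=Suc i..<?n. - scale ((-1) ^ (i + j)) (G (xs ! i) (xs ! j) (nths xs (- {i, j}))))"
    by (intro sum.cong refl high) auto
  also have "\<dots> = (\<Sum>j<?n. \<Sum>i<j. - scale ((-1) ^ (i + j)) (G (xs ! i) (xs ! j) (nths xs (- {i, j}))))"
  proof -
    have "{j \<in> {..<?n}. i < j} = {Suc i..<?n}" for i by auto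
    moreover have "{i \<in> {..<?n}. i < j} = {..<j}" if "j < ?n" for j using that by auto
    ultimately show ?thesis
      using sum.swap_restrict[of "{..<?n}" "{..<?n}"
          "\<lambda>i j. - scale ((-1) ^ (i + j)) (G (xs ! i) (xs ! j) (nths xs (- {i, j})))" "(<)"]
      by (simp cong: sum.cong_simp del: sum.lessThan_Suc sum.op_ivl_Suc)
  qed
  finally show ?thesis
    by (simp add: scale_right_diff_distrib sum_subtractf sum_negf del: sum.lessThan_Suc)
qed

lemma merge_insert_at:
  "q \<le> length ws \<Longrightarrow> merge \<mu> \<alpha> q (insert_at q a (insert_at q b ws)) = insert_at q (\<mu> a b) (map \<alpha> ws)"
  by (simp add: merge_def insert_at_def nth_append take_map drop_map min_def)

lemma multilinear_maps_insert_at_diff: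
  assumes f: "f \<in> multilinear_maps sA sM (Suc m)" and ws: "length ws = m" "q \<le> m"
  shows "f (insert_at q (a - b) ws) = f (insert_at q a ws) - f (insert_at q b ws)"
proof -
  have upd: "(insert_at q c ws)[q := d] = insert_at q d ws" for c d
    using ws by (simp add: insert_at_def list_update_append)
  interpret Vector_Spaces.linear sA sM "\<lambda>c. f ((insert_at q 0 ws)[q := c])"
    by (rule multilinear_maps_linear[OF f]) (use ws in auto)
  show ?thesis using diff[of a b] by (simp add: upd)
qed

context hom_bimodule
begin

lemma skew_symmetrization_coface_first:
  assumes xs: "length xs = Suc n"
  shows "skew_symmetrization sM (Suc n) (coface \<mu> \<alpha> l r n 0 f) xs =
    (\<Sum>i<Suc n. sM ((-1) ^ i) (l ((\<alpha> ^^ (n - 1)) (xs ! i)) (skew_symmetrization sM n f (nths xs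
        (- {i})))))"
proof -
  interpret M: vector_space sM by (rule vector_space_module)
  show ?thesis
    unfolding M.skew_symmetrization_expand_row[OF xs le0]
  proof (intro sum.cong refl arg_cong2[where f = sM])
    fix i assume "i \<in> {..<Suc n}"
    have "skew_symmetrization sM n (\<lambda>ys. coface \<mu> \<alpha> l r n 0 f (insert_at 0 (xs ! i) ys)) (omit i xs)
      = skew_symmetrization sM n (\<lambda>ys. l ((\<alpha> ^^ (n - 1)) (xs ! i)) (f ys)) (omit i xs)"
      by (rule skew_symmetrization_cong) (simp add: coface_def insert_at_def)
    then show "skew_symmetrization sM n (\<lambda>ys. coface \<mu> \<alpha> l r n 0 f (insert_at 0 (xs ! i) ys))
        (omit i xs)
      = l ((\<alpha> ^^ (n - 1)) (xs ! i)) (skew_symmetrization sM n f (nths xs (- {i})))"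
      using xs \<open>i \<in> _\<close> by (simp add: skew_symmetrization_linear_image[OF left_linear(1)]
          nths_delete_one)
  qed simp
qed

lemma skew_symmetrization_coface_last:
  assumes xs: "length xs = Suc n"
  shows "skew_symmetrization sM (Suc n) (coface \<mu> \<alpha> l r n (Suc n) f) xs =
    (\<Sum>i<Suc n. sM ((-1) ^ (n + i)) (r (skew_symmetrization sM n f (nths xs (- {i}))) ((\<alpha> ^^ (n -
        1)) (xs ! i))))"
proof -
  interpret M: vector_space sM by (rule vector_space_module)
  show ?thesis
    unfolding M.skew_symmetrization_expand_row[OF xs order_refl]
  proof (intro sum.cong refl arg_cong2[where f = sM])
    fix i assume "i \<in> {..<Suc n}"
    have "skew_symmetrization sM n (\<lambda>ys. coface \<mu> \<alpha> l r n (Suc n) f (insert_at n (xs ! i) ys))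
        (omit i xs)
      = skew_symmetrization sM n (\<lambda>ys. r (f ys) ((\<alpha> ^^ (n - 1)) (xs ! i))) (omit i xs)"
      by (rule skew_symmetrization_cong) (simp add: coface_def insert_at_def butlast_append)
    then show "skew_symmetrization sM n (\<lambda>ys. coface \<mu> \<alpha> l r n (Suc n) f (insert_at n (xs ! i)
        ys)) (omit i xs)
      = r (skew_symmetrization sM n f (nths xs (- {i}))) ((\<alpha> ^^ (n - 1)) (xs ! i))"
      using xs \<open>i \<in> _\<close> by (simp add: skew_symmetrization_linear_image[OF right_linear(2)]
          nths_delete_one)
  qed
qed

text \<open>
  Expanding twice along row \<open>q\<close> contributes the sign \<open>(-1)\<^bsup>2q\<^esup> = 1\<close>, so only the signs of the chosen
  positions remain. The two orders of each pair differ by a sign and, by linearity in slot \<open>q\<close>,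
  merge into the commutator.
\<close>

lemma skew_symmetrization_coface_inner:
  assumes f: "f \<in> multilinear_maps sA sM (Suc m)" and xs: "length xs = Suc (Suc m)" and q: "q \<le> m"
  shows "skew_symmetrization sM (Suc (Suc m)) (coface \<mu> \<alpha> l r (Suc m) (Suc q) f) xs =
    - (\<Sum>j<Suc (Suc m). \<Sum>i<j. sM ((-1) ^ (i + j))
        (skew_symmetrization sM m (\<lambda>ws. f (insert_at q (commutator \<mu> (xs ! i) (xs ! j)) ws))
          (map \<alpha> (nths xs (- {i, j})))))"
proof -
  interpret M: vector_space sM by (rule vector_space_module)
  let ?h = "coface \<mu> \<alpha> l r (Suc m) (Suc q) f"
  define G where "G a b zs = skew_symmetrization sM m (\<lambda>ws. f (insert_at q (\<mu> a b) ws)) (map \<alpha>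
      zs)" for a b zs
  have inner: "skew_symmetrization sM m (\<lambda>ws. ?h (insert_at q a (insert_at q b ws))) zs =
      G a b zs" for a b zs
    unfolding G_def skew_symmetrization_map[symmetric]
    by (rule skew_symmetrization_cong) (use q in \<open>simp add: coface_def merge_insert_at\<close>)
  have diff: "G a b zs - G b a zs =
    skew_symmetrization sM m (\<lambda>ws. f (insert_at q (commutator \<mu> a b) ws)) (map \<alpha> zs)" for a b zs
    unfolding G_def skew_symmetrization_def
    using q by (simp add: commutator_def multilinear_maps_insert_at_diff[OF f]
        M.scale_right_diff_distrib sum_subtractf)
  have "skew_symmetrization sM (Suc (Suc m)) ?h xs =
    (\<Sum>i<Suc (Suc m). sM ((-1) ^ (q + i)) (\<Sum>j<Suc m. sM ((-1) ^ (q + j))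
      (G (xs ! i) (omit i xs ! j) (omit j (omit i xs)))))"
  proof -
    have "skew_symmetrization sM (Suc m) (\<lambda>ys. ?h (insert_at q (xs ! i) ys)) (omit i xs) =
      (\<Sum>j<Suc m. sM ((-1) ^ (q + j)) (G (xs ! i) (omit i xs ! j) (omit j (omit i xs))))"
      if "i < Suc (Suc m)" for i
      using that xs q by (subst M.skew_symmetrization_expand_row[where p =
          q]) (simp_all only: inner length_omit)
    then show ?thesis using xs q
      by (subst M.skew_symmetrization_expand_row[where p =
          q]) (auto intro!: sum.cong simp del: sum.lessThan_Suc)
  qed
  also have "\<dots> = (\<Sum>i<Suc (Suc m). \<Sum>j<Suc m. sM ((-1) ^ (i + j))
      (G (xs ! i) (omit i xs ! j) (omit j (omit i xs))))"
  proof -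
    have sgn: "(-1) ^ (q + i) * (-1) ^ (q + j) = ((-1) ^ (i + j) :: 'k)" for i j
      by (simp add: minus_one_power_iff)
    show ?thesis by (simp only: M.scale_sum_right M.scale_scale sgn)
  qed
  also have "\<dots> = - (\<Sum>j<Suc (Suc m). \<Sum>i<j. sM ((-1) ^ (i + j))
          (G (xs ! i) (xs ! j) (nths xs (- {i, j})) - G (xs ! j) (xs ! i) (nths xs (- {i, j}))))"
    by (rule M.sum_over_ordered_pairs[OF xs])
  also have "\<dots> = - (\<Sum>j<Suc (Suc m). \<Sum>i<j. sM ((-1) ^ (i + j))
        (skew_symmetrization sM m (\<lambda>ws. f (insert_at q (commutator \<mu> (xs ! i) (xs ! j)) ws))
          (map \<alpha> (nths xs (- {i, j})))))"
    by (simp only: diff)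
  finally show ?thesis .
qed

text \<open>
  The outer cofaces give the first sum of the Hom-Lie differential. For the inner ones the sum over
  the slot \<open>q\<close> holding the bracket is a column expansion, along column \<open>0\<close>, of the
  skew-symmetrization with the bracket as first argument.
\<close>

lemma skew_symmetrization_differential:
  assumes f: "f \<in> multilinear_maps sA sM n" and n: "n \<ge> 1"
  shows "skew_symmetrization sM (Suc n) (hom_assoc_differential sM \<mu> \<alpha> l r n f) =
    hom_lie_differential sM (commutator \<mu>) \<alpha> (commutator_action l r) n (skew_symmetrization sM n f)"
proof
  fix xs
  interpret M: vector_space sM by (rule vector_space_module)
  obtain m where m: "n = Suc m" using n by (cases n) auto
  let ?S = "skew_symmetrization sM"
  show "?S (Suc n) (hom_assoc_differential sM \<mu> \<alpha> l r n f) xs =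
    hom_lie_differential sM (commutator \<mu>) \<alpha> (commutator_action l r) n (?S n f) xs"
  proof (cases "length xs = Suc n")
    case xs: True
    let ?P = "\<lambda>q i j. ?S m (\<lambda>ws. f (insert_at q (commutator \<mu> (xs ! i) (xs ! j)) ws)) (map \<alpha>
        (nths xs (- {i, j})))"
    have "?S (Suc n) (hom_assoc_differential sM \<mu> \<alpha> l r n f) xs =
      (\<Sum>i<Suc (Suc n). sM ((-1) ^ i) (?S (Suc n) (coface \<mu> \<alpha> l r n i f) xs))"
      unfolding hom_assoc_differential_eq_coface_sum[OF vector_space_module]
        skew_symmetrization_sum[OF vector_space_module] skew_symmetrization_scale[OF
            vector_space_module]
        sum_fun_apply ..
    also have "\<dots> = ?S (Suc n) (coface \<mu> \<alpha> l r n 0 f) xs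
        + sM ((-1) ^ Suc n) (?S (Suc n) (coface \<mu> \<alpha> l r n (Suc n) f) xs)
        + (\<Sum>q<n. sM ((-1) ^ Suc q) (?S (Suc n) (coface \<mu> \<alpha> l r n (Suc q) f) xs))"
      by (subst sum.lessThan_Suc, subst sum.lessThan_Suc_shift) (simp add: add_ac)
    also have "?S (Suc n) (coface \<mu> \<alpha> l r n 0 f) xs
        + sM ((-1) ^ Suc n) (?S (Suc n) (coface \<mu> \<alpha> l r n (Suc n) f) xs) =
      (\<Sum>i<Suc n. sM ((-1) ^ i) (commutator_action l r ((\<alpha> ^^ (n - 1)) (xs ! i)) (?S n f (nths xs
          (- {i})))))"
    proof -
      have sgn: "(-1) ^ Suc n * (-1) ^ (n + i) = (- ((-1) ^ i) :: 'k)" for i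
        by (simp add: minus_one_power_iff)
      show ?thesis
        unfolding skew_symmetrization_coface_first[OF xs] skew_symmetrization_coface_last[OF xs]
          M.scale_sum_right M.scale_scale sgn commutator_action_def
        by (simp only: M.scale_right_diff_distrib sum_subtractf M.scale_minus_left sum_negf) simp
    qed
    also have "(\<Sum>q<n. sM ((-1) ^ Suc q) (?S (Suc n) (coface \<mu> \<alpha> l r n (Suc q) f) xs)) =
      (\<Sum>j<Suc n. \<Sum>i<j. sM ((-1) ^ (i + j)) (?S n f (commutator \<mu> (xs ! i) (xs ! j) # map \<alpha> (nths
          xs (- {i, j})))))"
    proof -
      have "(\<Sum>q<n. sM ((-1) ^ Suc q) (?S (Suc n) (coface \<mu> \<alpha> l r n (Suc q) f) xs)) =
        (\<Sum>q<n. \<Sum>j<Suc n. \<Sum>i<j. sM ((-1) ^ (i + j)) (sM ((-1) ^ q) (?P q i j)))"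
      proof (rule sum.cong[OF refl])
        fix q assume "q \<in> {..<n}"
        then have q: "q \<le> m" using m by simp
        have "sM ((-1) ^ Suc q) (?S (Suc n) (coface \<mu> \<alpha> l r n (Suc q) f) xs) =
          sM ((-1) ^ q) (\<Sum>j<Suc n. \<Sum>i<j. sM ((-1) ^ (i + j)) (?P q i j))"
          using skew_symmetrization_coface_inner[of f m xs q] f xs q unfolding m
          by (simp del: sum.lessThan_Suc)
        then show "sM ((-1) ^ Suc q) (?S (Suc n) (coface \<mu> \<alpha> l r n (Suc q) f) xs) =
          (\<Sum>j<Suc n. \<Sum>i<j. sM ((-1) ^ (i + j)) (sM ((-1) ^ q) (?P q i j)))"
          by (simp only: M.scale_sum_right M.scale_scale mult.commute)
      qed
      also have "\<dots> = (\<Sum>j<Suc n. \<Sum>i<j. sM ((-1) ^ (i + j)) (\<Sum>q<n. sM ((-1) ^ q) (?P q i j)))"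
        unfolding M.scale_sum_right
        by (rule trans[OF sum.swap]) (intro sum.cong refl sum.swap)
      also have "\<dots> = (\<Sum>j<Suc n. \<Sum>i<j. sM ((-1) ^ (i + j))
          (?S n f (commutator \<mu> (xs ! i) (xs ! j) # map \<alpha> (nths xs (- {i, j})))))"
      proof (intro sum.cong refl arg_cong2[where f = sM])
        fix j i assume "j \<in> {..<Suc n}" "i \<in> {..<j}"
        then have len: "length (nths xs (- {i, j})) = m"
          using xs m by (simp add: nths_delete_two)
        show "(\<Sum>q<n. sM ((-1) ^ q) (?P q i j)) =
          ?S n f (commutator \<mu> (xs ! i) (xs ! j) # map \<alpha> (nths xs (- {i, j})))"
          unfolding m
          by (subst M.skew_symmetrization_expand_column[where i = 0]) (simp_all add: len omit_def)
      qed
      finally show ?thesis .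
    qed
    finally show ?thesis using xs by (simp add: hom_lie_differential_def)
  qed (simp add: skew_symmetrization_def hom_lie_differential_def)
qed

end


section \<open>Commutators and sums of compatible structures\<close>

lemma bilinear_map_iff:
  "bilinear_map s1 s2 s3 f \<longleftrightarrow> vector_space s1 \<and> vector_space s2 \<and> vector_space s3 \<and>
     (\<forall>x y z. f x (y + z) = f x y + f x z) \<and> (\<forall>x y z. f (x + y) z = f x z + f y z) \<and>
     (\<forall>c x y. f x (s2 c y) = s3 c (f x y)) \<and> (\<forall>c x y. f (s1 c x) y = s3 c (f x y))"
  by (auto simp: bilinear_map_def Vector_Spaces.linear_iff)

lemma bilinear_map_add:
  assumes "bilinear_map s1 s2 s3 f" "bilinear_map s1 s2 s3 g"
  shows "bilinear_map s1 s2 s3 (\<lambda>x y. f x y + g x y)"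
proof -
  interpret vector_space s3 using assms(1) by (simp add: bilinear_map_iff)
  show ?thesis using assms by (simp add: bilinear_map_iff scale_right_distrib)
qed

lemma bilinear_map_diff:
  assumes "bilinear_map s1 s2 s3 f" "bilinear_map s1 s2 s3 g"
  shows "bilinear_map s1 s2 s3 (\<lambda>x y. f x y - g x y)"
proof -
  interpret vector_space s3 using assms(1) by (simp add: bilinear_map_iff)
  show ?thesis using assms by (simp add: bilinear_map_iff scale_right_diff_distrib)
qed

lemma bilinear_map_flip: "bilinear_map s1 s2 s3 f \<Longrightarrow> bilinear_map s2 s1 s3 (\<lambda>x y. f y x)"
  by (auto simp: bilinear_map_def)

lemma bilinear_map_diff_simps:
  assumes "bilinear_map s1 s2 s3 f"
  shows "f (x - y) z = f x z - f y z" "f x (u - v) = f x u - f x v"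
proof -
  have "f ((x - y) + y) z = f (x - y) z + f y z" "f x ((u - v) + v) = f x (u - v) + f x v"
    using assms unfolding bilinear_map_iff by blast+
  then show "f (x - y) z = f x z - f y z" "f x (u - v) = f x u - f x v" by simp_all
qed

context hom_assoc_algebra
begin

lemma bilinear_commutator: "bilinear_map sA sA sA (commutator \<mu>)"
  unfolding commutator_def[abs_def]
  by (rule bilinear_map_diff[OF bilinear_mult bilinear_map_flip[OF bilinear_mult]])

lemma hom_lie_algebra_commutator: "hom_lie_algebra sA (commutator \<mu>) \<alpha>"
proof -
  interpret \<alpha>: Vector_Spaces.linear sA sA \<alpha> by (rule linear_twist)
  show ?thesis
  proof
  show "commutator \<mu> (commutator \<mu> x y) (\<alpha> z) + commutator \<mu> (commutator \<mu> y z) (\<alpha> x) +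
      commutator \<mu> (commutator \<mu> z x) (\<alpha> y) = 0" for x y z
    by (simp add: commutator_def bilinear_map_diff_simps[OF bilinear_mult] hom_assoc)
qed (simp_all add: bilinear_commutator linear_twist commutator_def twist_mult \<alpha>.diff)
qed

end

context hom_bimodule
begin

lemma hom_lie_representation_commutator:
  "hom_lie_representation sA sM (commutator \<mu>) \<alpha> (commutator_action l r) \<beta>"
proof -
  interpret hom_lie_algebra sA "commutator \<mu>" \<alpha> by (rule hom_lie_algebra_commutator)
  interpret \<beta>: Vector_Spaces.linear sM sM \<beta> by (rule linear_mod_twist)
  show ?thesis
  proof
    show "bilinear_map sA sM sM (commutator_action l r)"
      unfolding commutator_action_def[abs_def]
      by (rule bilinear_map_diff[OF bilinear_left bilinear_map_flip[OF bilinear_right]])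
    show "commutator_action l r (commutator \<mu> x y) (\<beta> v) =
        commutator_action l r (\<alpha> x) (commutator_action l r y v) -
        commutator_action l r (\<alpha> y) (commutator_action l r x v)" for x y v
      by (simp add: commutator_def commutator_action_def bilinear_map_diff_simps[OF bilinear_left]
          bilinear_map_diff_simps[OF bilinear_right] left_left left_right right_right)
  qed (simp_all add: commutator_action_def twist_left twist_right \<beta>.diff)
qed

end

context compatible_hom_assoc_algebra
begin

text \<open>
  Compatibility is used as a rewrite rule that eliminates one of the two kinds of mixed products
  bracketed to the left; the remaining terms cancel in pairs.
\<close>

lemma compatible_hom_lie_algebra_commutator:
  "compatible_hom_lie_algebra sA (commutator \<mu>1) (commutator \<mu>2) \<alpha>"
proof -
  interpret L1: hom_lie_algebra sA "commutator \<mu>1" \<alpha> by (rule alg1.hom_lie_algebra_commutator)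
  interpret L2: hom_lie_algebra sA "commutator \<mu>2" \<alpha> by (rule alg2.hom_lie_algebra_commutator)
  have mixed: "\<mu>2 (\<mu>1 a b) (\<alpha> c) = \<mu>1 (\<alpha> a) (\<mu>2 b c) + \<mu>2 (\<alpha> a) (\<mu>1 b c) - \<mu>1 (\<mu>2 a b) (\<alpha> c)"
      for a b c
    using compatible_mult[of a b c] by (simp add: eq_diff_eq)
  show ?thesis
    by unfold_locales
      (simp add: commutator_def bilinear_map_diff_simps[OF alg1.bilinear_mult]
        bilinear_map_diff_simps[OF alg2.bilinear_mult] mixed)
qed

text \<open>
  The compatibility condition is exactly the mixed part of Hom-associativity of the sum of the
  two products.
\<close>

lemma hom_assoc_algebra_sum: "hom_assoc_algebra sA (\<lambda>a b. \<mu>1 a b + \<mu>2 a b) \<alpha>"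
proof -
  interpret \<alpha>: Vector_Spaces.linear sA sA \<alpha> by (rule alg1.linear_twist)
  show ?thesis
  proof
  show "bilinear_map sA sA sA (\<lambda>a b. \<mu>1 a b + \<mu>2 a b)"
    by (rule bilinear_map_add[OF alg1.bilinear_mult alg2.bilinear_mult])
  show "\<alpha> (\<mu>1 a b + \<mu>2 a b) = \<mu>1 (\<alpha> a) (\<alpha> b) + \<mu>2 (\<alpha> a) (\<alpha> b)" for a b
    by (simp add: \<alpha>.add alg1.twist_mult alg2.twist_mult)
  show "\<mu>1 (\<mu>1 a b + \<mu>2 a b) (\<alpha> c) + \<mu>2 (\<mu>1 a b + \<mu>2 a b) (\<alpha> c) =
    \<mu>1 (\<alpha> a) (\<mu>1 b c + \<mu>2 b c) + \<mu>2 (\<alpha> a) (\<mu>1 b c + \<mu>2 b c)" for a b c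
    using alg1.bilinear_mult alg2.bilinear_mult compatible_mult[of a b c]
    by (simp add: bilinear_map_iff alg1.hom_assoc alg2.hom_assoc algebra_simps)
qed
qed

end

context compatible_hom_bimodule
begin

lemma compatible_hom_lie_representation_commutator:
  "compatible_hom_lie_representation sA sM (commutator \<mu>1) (commutator \<mu>2) \<alpha>
     (commutator_action l1 r1) (commutator_action l2 r2) \<beta>"
proof -
  interpret compatible_hom_lie_algebra sA "commutator \<mu>1" "commutator \<mu>2" \<alpha>
    by (rule compatible_hom_lie_algebra_commutator)
  interpret R1: hom_lie_representation sA sM "commutator \<mu>1" \<alpha> "commutator_action l1 r1" \<beta>
    by (rule mod1.hom_lie_representation_commutator)
  interpret R2: hom_lie_representation sA sM "commutator \<mu>2" \<alpha> "commutator_action l2 r2" \<beta>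
    by (rule mod2.hom_lie_representation_commutator)
  have mixed: "l2 (\<mu>1 a b) (\<beta> m) = l1 (\<alpha> a) (l2 b m) + l2 (\<alpha> a) (l1 b m) - l1 (\<mu>2 a b) (\<beta> m)"
    "r2 (l1 a m) (\<alpha> b) = l1 (\<alpha> a) (r2 m b) + l2 (\<alpha> a) (r1 m b) - r1 (l2 a m) (\<alpha> b)"
    "r2 (r1 m a) (\<alpha> b) = r1 (\<beta> m) (\<mu>2 a b) + r2 (\<beta> m) (\<mu>1 a b) - r1 (r2 m a) (\<alpha> b)" for a b m
    using compatible_left_left[of a b m] compatible_left_right[of a m b]
        compatible_right_right[of m a b]
    by (simp_all add: eq_diff_eq)
  show ?thesis
    by unfold_locales
      (simp add: commutator_def commutator_action_def bilinear_map_diff_simps[OF mod1.bilinear_left]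
        bilinear_map_diff_simps[OF mod2.bilinear_left] bilinear_map_diff_simps[OF
            mod1.bilinear_right]
        bilinear_map_diff_simps[OF mod2.bilinear_right] mixed)
qed

lemma hom_bimodule_sum:
  "hom_bimodule sA sM (\<lambda>a b. \<mu>1 a b + \<mu>2 a b) \<alpha> (\<lambda>a m. l1 a m + l2 a m) (\<lambda>m a. r1 m a + r2 m a) \<beta>"
proof -
  interpret hom_assoc_algebra sA "\<lambda>a b. \<mu>1 a b + \<mu>2 a b" \<alpha> by (rule hom_assoc_algebra_sum)
  note bil = mod1.bilinear_left mod2.bilinear_left mod1.bilinear_right mod2.bilinear_right
  interpret \<beta>: Vector_Spaces.linear sM sM \<beta> by (rule mod1.linear_mod_twist)
  show ?thesis
  proof
    show "bilinear_map sA sM sM (\<lambda>a m. l1 a m + l2 a m)"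
      by (rule bilinear_map_add[OF bil(1,2)])
    show "bilinear_map sM sA sM (\<lambda>m a. r1 m a + r2 m a)"
      by (rule bilinear_map_add[OF bil(3,4)])
    show "l1 (\<mu>1 a b + \<mu>2 a b) (\<beta> m) + l2 (\<mu>1 a b + \<mu>2 a b) (\<beta> m) =
        l1 (\<alpha> a) (l1 b m + l2 b m) + l2 (\<alpha> a) (l1 b m + l2 b m)" for a b m
      using bil compatible_left_left[of a b m]
      by (simp add: bilinear_map_iff mod1.left_left mod2.left_left algebra_simps)
    show "r1 (l1 a m + l2 a m) (\<alpha> b) + r2 (l1 a m + l2 a m) (\<alpha> b) =
        l1 (\<alpha> a) (r1 m b + r2 m b) + l2 (\<alpha> a) (r1 m b + r2 m b)" for a b m
      using bil compatible_left_right[of a m b]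
      by (simp add: bilinear_map_iff mod1.left_right mod2.left_right algebra_simps)
    show "r1 (r1 m a + r2 m a) (\<alpha> b) + r2 (r1 m a + r2 m a) (\<alpha> b) =
        r1 (\<beta> m) (\<mu>1 a b + \<mu>2 a b) + r2 (\<beta> m) (\<mu>1 a b + \<mu>2 a b)" for a b m
      using bil compatible_right_right[of m a b]
      by (simp add: bilinear_map_iff mod1.right_right mod2.right_right algebra_simps)
  qed (simp_all add: mod1.bij_mod_twist \<beta>.add mod1.twist_left mod2.twist_left
      mod1.twist_right mod2.twist_right)
qed

end

text \<open>
  The differential depends additively on the product and the actions. For the product this uses
  linearity of \<open>f\<close> in the slot holding it.
\<close>

lemma hom_assoc_differential_sum:
  assumes M: "vector_space sM" and f: "f \<in> multilinear_maps sA sM n"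
  shows "hom_assoc_differential sM (\<lambda>a b. \<mu>1 a b + \<mu>2 a b) \<alpha> (\<lambda>a m. l1 a m +
      l2 a m) (\<lambda>m a. r1 m a + r2 m a) n f =
    hom_assoc_differential sM \<mu>1 \<alpha> l1 r1 n f + hom_assoc_differential sM \<mu>2 \<alpha> l2 r2 n f"
proof
  fix xs
  interpret M: vector_space sM by fact
  have "f (map \<alpha> (take i xs) @ [\<mu>1 (xs ! i) (xs ! (i + 1)) + \<mu>2 (xs ! i) (xs ! (i + 1))] @
      map \<alpha> (drop (i + 2) xs)) =
      f (map \<alpha> (take i xs) @ [\<mu>1 (xs ! i) (xs ! (i + 1))] @ map \<alpha> (drop (i + 2) xs)) +
      f (map \<alpha> (take i xs) @ [\<mu>2 (xs ! i) (xs ! (i + 1))] @ map \<alpha> (drop (i + 2) xs))"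
    if xs: "length xs = n + 1" and i: "i < n" for i
  proof -
    let ?ys = "map \<alpha> (take i xs) @ [0] @ map \<alpha> (drop (i + 2) xs)"
    interpret Vector_Spaces.linear sA sM "\<lambda>a. f (?ys[i := a])"
      by (rule multilinear_maps_linear[OF f]) (use xs i in auto)
    show ?thesis
      using add[of "\<mu>1 (xs ! i) (xs ! (i + 1))" "\<mu>2 (xs ! i) (xs ! (i + 1))"] xs i
      by (simp add: list_update_append)
  qed
  then show "hom_assoc_differential sM (\<lambda>a b. \<mu>1 a b + \<mu>2 a b) \<alpha> (\<lambda>a m. l1 a m +
      l2 a m) (\<lambda>m a. r1 m a + r2 m a) n f xs =
    (hom_assoc_differential sM \<mu>1 \<alpha> l1 r1 n f + hom_assoc_differential sM \<mu>2 \<alpha> l2 r2 n f) xs"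
    by (simp add: hom_assoc_differential_def M.scale_right_distrib sum.distrib sum_subtractf
        sum_negf algebra_simps)
qed


section \<open>Cochain maps and their action on cohomology\<close>

text \<open>
  Each cochain of the target is an image, so every axiom of the target is the image of the same
  axiom of the source.
\<close>

lemma cochain_map_onto:
  assumes C: "cochain_complex s C d" and s': "vector_space s'"
    and onto: "\<And>n. n \<ge> 1 \<Longrightarrow> \<theta> n ` C n = C' n"
    and lin: "\<And>n. n \<ge> 1 \<Longrightarrow> linear_map_on s s' (C n) (\<theta> n)"
    and comm: "\<And>n f. n \<ge> 1 \<Longrightarrow> f \<in> C n \<Longrightarrow> \<theta> (Suc n) (d n f) = d' n (\<theta> n f)"
  shows "cochain_map s C d s' C' d' \<theta>"
proof -
  interpret C: cochain_complex s C d by fact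
  interpret V': vector_space s' by fact
  have add: "\<theta> n (f + g) = \<theta> n f + \<theta> n g" if "n \<ge> 1" "f \<in> C n" "g \<in> C n" for n f g
    using lin[OF that(1)] that by (simp add: linear_map_on_def)
  have scale: "\<theta> n (s c f) = s' c (\<theta> n f)" if "n \<ge> 1" "f \<in> C n" for n c f
    using lin[OF that(1)] that by (simp add: linear_map_on_def)
  have dadd: "d n (f + g) = d n f + d n g" if "n \<ge> 1" "f \<in> C n" "g \<in> C n" for n f g
    using C.differential_linear[OF that(1)] that by (simp add: linear_map_on_def)
  have dscale: "d n (s c f) = s c (d n f)" if "n \<ge> 1" "f \<in> C n" for n c f
    using C.differential_linear[OF that(1)] that by (simp add: linear_map_on_def)
  have dinto: "d n f \<in> C (Suc n)" if "n \<ge> 1" "f \<in> C n" for n f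
    using C.differential_into[OF that(1)] that by auto
  have ex: "\<exists>f \<in> C n. g = \<theta> n f" if "n \<ge> 1" "g \<in> C' n" for n g
    using onto[OF that(1)] that by auto
  have into: "\<theta> n f \<in> C' n" if "n \<ge> 1" "f \<in> C n" for n f
    using onto[OF that(1)] that by auto
  have zero: "\<theta> n 0 = 0" if "n \<ge> 1" for n
    using scale[OF that C.subspace_0[OF C.subspace_cochains[OF that]], of 0] by simp
  have sub: "V'.subspace (C' n)" if n: "n \<ge> 1" for n
  proof (rule V'.subspaceI)
    show "0 \<in> C' n"
      using into[OF n C.subspace_0[OF C.subspace_cochains[OF n]]] n by (simp add: zero)
    show "x + y \<in> C' n" if xy: "x \<in> C' n" "y \<in> C' n" for x y
    proof -
      obtain f g where "f \<in> C n" "g \<in> C n" "x = \<theta> n f" "y = \<theta> n g"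
        using ex[OF n xy(1)] ex[OF n xy(2)] by blast
      then show ?thesis
        using into[OF n C.subspace_add[OF C.subspace_cochains[OF n], of f g]] n by (simp add: add)
    qed
    show "s' c x \<in> C' n" if x: "x \<in> C' n" for c x
    proof -
      obtain f where "f \<in> C n" "x = \<theta> n f" using ex[OF n x] by blast
      then show ?thesis
        using into[OF n C.subspace_scale[OF C.subspace_cochains[OF n], of f c]] n
            by (simp add: scale)
    qed
  qed
  have d'into: "d' n \<in> C' n \<rightarrow> C' (Suc n)" if n: "n \<ge> 1" for n
  proof
    fix x assume "x \<in> C' n"
    then obtain f where "f \<in> C n" "x = \<theta> n f" using ex[OF n] by blast
    then show "d' n x \<in> C' (Suc n)"
      using into[of "Suc n" "d n f"] n by (simp add: dinto flip: comm)
  qed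
  have d'lin: "linear_map_on s' s' (C' n) (d' n)" if n: "n \<ge> 1" for n
    unfolding linear_map_on_def
  proof (intro conjI ballI allI)
    fix x y assume "x \<in> C' n" "y \<in> C' n"
    then obtain f g where fg: "f \<in> C n" "g \<in> C n" "x = \<theta> n f" "y = \<theta> n g"
      using ex[OF n, of x] ex[OF n, of y] by blast
    have "d' n (x + y) = \<theta> (Suc n) (d n (f + g))"
      using fg n C.subspace_add[OF C.subspace_cochains[OF n], of f g] by (simp add: comm add)
    also have "\<dots> = d' n x + d' n y"
      using fg n by (simp add: dadd add dinto comm)
    finally show "d' n (x + y) = d' n x + d' n y" .
  next
    fix c x assume "x \<in> C' n"
    then obtain f where f: "f \<in> C n" "x = \<theta> n f" using ex[OF n, of x] by blast
    have "d' n (s' c x) = \<theta> (Suc n) (d n (s c f))"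
      using f n C.subspace_scale[OF C.subspace_cochains[OF n], of f c] by (simp add: comm scale)
    also have "\<dots> = s' c (d' n x)"
      using f n by (simp add: dscale scale dinto comm)
    finally show "d' n (s' c x) = s' c (d' n x)" .
  qed
  have d'd': "d' (Suc n) (d' n x) = 0" if n: "n \<ge> 1" and x: "x \<in> C' n" for n x
  proof -
    obtain f where f: "f \<in> C n" "x = \<theta> n f" using ex[OF n x] by blast
    then have "d' (Suc n) (d' n x) = \<theta> (Suc (Suc n)) (d (Suc n) (d n f))"
      using n by (simp add: comm dinto)
    then show ?thesis
      using f n by (simp add: C.differential_square zero)
  qed
  interpret C': cochain_complex s' C' d'
    by unfold_locales (use sub d'into d'lin d'd' in auto)
  show ?thesis
    by unfold_locales (use into lin comm in auto)
qed

context cochain_complex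
begin

lemma zero_cochain: "n \<ge> 1 \<Longrightarrow> 0 \<in> C n"
  and add_cochain: "n \<ge> 1 \<Longrightarrow> f \<in> C n \<Longrightarrow> g \<in> C n \<Longrightarrow> f + g \<in> C n"
  and scale_cochain: "n \<ge> 1 \<Longrightarrow> f \<in> C n \<Longrightarrow> s c f \<in> C n"
  and diff_cochain: "n \<ge> 1 \<Longrightarrow> f \<in> C n \<Longrightarrow> g \<in> C n \<Longrightarrow> f - g \<in> C n"
  using subspace_cochains by (auto intro: subspace_0 subspace_add subspace_scale subspace_diff)

lemma differential_add: "n \<ge> 1 \<Longrightarrow> f \<in> C n \<Longrightarrow> g \<in> C n \<Longrightarrow> d n (f + g) = d n f + d n g"
  and differential_scale: "n \<ge> 1 \<Longrightarrow> f \<in> C n \<Longrightarrow> d n (s c f) = s c (d n f)"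
  using differential_linear by (auto simp: linear_map_on_def)

lemma subspace_cocycles: "n \<ge> 1 \<Longrightarrow> subspace (cocycles C d n)"
  using differential_scale[OF _ zero_cochain, of n 0]
  by (auto simp: subspace_def cocycles_def zero_cochain add_cochain scale_cochain
      differential_add differential_scale)

lemma subspace_coboundaries: "n \<ge> 1 \<Longrightarrow> subspace (coboundaries C d n)"
proof (cases "n \<le> 1")
  case False
  then obtain m where m: "n = Suc m" "m \<ge> 1" by (cases n) auto
  show ?thesis
  proof (rule subspaceI)
    show "0 \<in> coboundaries C d n"
      using m differential_scale[OF m(2) zero_cochain, of 0] zero_cochain[OF m(2)]
      by (force simp: coboundaries_def)
    show "x + y \<in> coboundaries C d n" if "x \<in> coboundaries C d n" "y \<in> coboundaries C d n" for x y
      using that m add_cochain by (auto simp: coboundaries_def simp flip: differential_add)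
    show "s c x \<in> coboundaries C d n" if "x \<in> coboundaries C d n" for c x
      using that m scale_cochain by (auto simp: coboundaries_def simp flip: differential_scale)
  qed
qed (simp add: coboundaries_def)

lemma equiv_cohomologous: "n \<ge> 1 \<Longrightarrow> equiv (cocycles C d n) (cohomologous C d n)"
proof (rule equivI)
  assume n: "n \<ge> 1"
  note B = subspace_coboundaries[OF n]
  show "cohomologous C d n \<subseteq> cocycles C d n \<times> cocycles C d n"
    by (auto simp: cohomologous_def)
  show "refl_on (cocycles C d n) (cohomologous C d n)"
    using subspace_0[OF B] by (auto simp: refl_on_def cohomologous_def)
  show "sym (cohomologous C d n)"
    using subspace_neg[OF B] by (auto simp: sym_def cohomologous_def) (metis minus_diff_eq)
  show "trans (cohomologous C d n)"
    using subspace_add[OF B] by (auto simp: trans_def cohomologous_def) (metis diff_add_cancel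
        add_diff_eq)
qed

lemma cohomology_class_eq_iff:
  assumes "n \<ge> 1" "f \<in> cocycles C d n" "g \<in> cocycles C d n"
  shows "cohomology_class C d n f = cohomology_class C d n g \<longleftrightarrow> f - g \<in> coboundaries C d n"
  using eq_equiv_class_iff[OF equiv_cohomologous[OF assms(1)] assms(2,3)] assms
  by (simp add: cohomology_class_def cohomologous_def)

lemma mem_cohomology_class_iff:
  assumes "n \<ge> 1" "f \<in> cocycles C d n"
  shows "g \<in> cohomology_class C d n f \<longleftrightarrow>
    g \<in> cocycles C d n \<and> cohomology_class C d n g = cohomology_class C d n f"
proof
  assume "g \<in> cohomology_class C d n f"
  then have "f - g \<in> coboundaries C d n" "g \<in> cocycles C d n"
    by (auto simp: cohomology_class_def cohomologous_def)
  then show "g \<in> cocycles C d n \<and> cohomology_class C d n g = cohomology_class C d n f"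
    using cohomology_class_eq_iff[of n f g] assms by simp
next
  assume "g \<in> cocycles C d n \<and> cohomology_class C d n g = cohomology_class C d n f"
  then show "g \<in> cohomology_class C d n f"
    using cohomology_class_eq_iff[of n f g] assms
    by (auto simp: cohomology_class_def cohomologous_def)
qed

lemma cohomology_cases:
  assumes "X \<in> cohomology C d n"
  obtains f where "f \<in> cocycles C d n" "X = cohomology_class C d n f"
  using assms by (auto simp: cohomology_def cohomology_class_def elim: quotientE)

lemma cohomology_class_in_cohomology:
  "f \<in> cocycles C d n \<Longrightarrow> cohomology_class C d n f \<in> cohomology C d n"
  by (auto simp: cohomology_def cohomology_class_def intro: quotientI)

lemma cohomology_add_classes:
  assumes n: "n \<ge> 1" and fg: "f \<in> cocycles C d n" "g \<in> cocycles C d n"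
  shows "cohomology_add C d n (cohomology_class C d n f) (cohomology_class C d n g) =
    cohomology_class C d n (f + g)"
proof -
  have "cohomology_class C d n (f' + g') = cohomology_class C d n (f + g)"
    if "f' \<in> cohomology_class C d n f" "g' \<in> cohomology_class C d n g" for f' g'
  proof -
    have f': "f' \<in> cocycles C d n" "f' - f \<in> coboundaries C d n"
      and g': "g' \<in> cocycles C d n" "g' - g \<in> coboundaries C d n"
      using that fg n by (auto simp: mem_cohomology_class_iff cohomology_class_eq_iff)
    \<comment> \<open>Other representatives change the sum by a coboundary, so all classes united in the
      definition of addition coincide.\<close>
    have "f' + g' - (f + g) \<in> coboundaries C d n"
      using subspace_add[OF subspace_coboundaries[OF n] f'(2) g'(2)] by (simp add: algebra_simps)
    then show ?thesis
      using f' g' fg n by (simp add: cohomology_class_eq_iff subspace_add[OF subspace_cocycles])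
  qed
  moreover have "f \<in> cohomology_class C d n f" "g \<in> cohomology_class C d n g"
    using fg n by (auto simp: mem_cohomology_class_iff)
  ultimately show ?thesis unfolding cohomology_add_def by blast
qed

lemma cohomology_scale_class:
  assumes n: "n \<ge> 1" and f: "f \<in> cocycles C d n"
  shows "cohomology_scale s C d n c (cohomology_class C d n f) = cohomology_class C d n (s c f)"
proof -
  have "cohomology_class C d n (s c f') = cohomology_class C d n (s c f)"
    if "f' \<in> cohomology_class C d n f" for f'
  proof -
    have f': "f' \<in> cocycles C d n" "f' - f \<in> coboundaries C d n"
      using that f n by (auto simp: mem_cohomology_class_iff cohomology_class_eq_iff)
    have "s c f' - s c f \<in> coboundaries C d n"
      using subspace_scale[OF subspace_coboundaries[OF n] f'(2), of c]
      by (simp add: scale_right_diff_distrib)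
    then show ?thesis
      using f' f n by (simp add: cohomology_class_eq_iff subspace_scale[OF subspace_cocycles])
  qed
  moreover have "f \<in> cohomology_class C d n f"
    using f n by (auto simp: mem_cohomology_class_iff)
  ultimately show ?thesis unfolding cohomology_scale_def by blast
qed

end

context cochain_map
begin

lemma map_add: "n \<ge> 1 \<Longrightarrow> f \<in> C n \<Longrightarrow> g \<in> C n \<Longrightarrow> \<theta> n (f + g) = \<theta> n f + \<theta> n g"
  and map_scale: "n \<ge> 1 \<Longrightarrow> f \<in> C n \<Longrightarrow> \<theta> n (s c f) = s' c (\<theta> n f)"
  using map_linear by (auto simp: linear_map_on_def)

lemma map_zero: "n \<ge> 1 \<Longrightarrow> \<theta> n 0 = 0"
  using map_scale[of n 0 0] source.zero_cochain[of n] by simp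

lemma map_diff: "n \<ge> 1 \<Longrightarrow> f \<in> C n \<Longrightarrow> g \<in> C n \<Longrightarrow> \<theta> n (f - g) = \<theta> n f - \<theta> n g"
  using map_add[of n "f - g" g] source.diff_cochain[of n f g] by (simp add: eq_diff_eq)

lemma map_cocycle: "n \<ge> 1 \<Longrightarrow> f \<in> cocycles C d n \<Longrightarrow> \<theta> n f \<in> cocycles C' d' n"
  using map_into[of n] map_differential[of n f] map_zero[of "Suc n"] by (auto simp: cocycles_def)

lemma map_coboundary: "n \<ge> 1 \<Longrightarrow> f \<in> coboundaries C d n \<Longrightarrow> \<theta> n f \<in> coboundaries C' d' n"
proof -
  assume n: "n \<ge> 1" and f: "f \<in> coboundaries C d n"
  show ?thesis
  proof (cases "n \<le> 1")
    case True
    then show ?thesis using f n by (simp add: coboundaries_def map_zero)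
  next
    case False
    then obtain m where m: "n = Suc m" "m \<ge> 1" by (cases n) auto
    then obtain g where "g \<in> C m" "f = d m g" using f by (auto simp: coboundaries_def)
    then show ?thesis using m map_into[OF m(2)] by (auto simp: coboundaries_def map_differential)
  qed
qed

text \<open>
  Existence is well-definedness on classes, as coboundaries go to coboundaries. Uniqueness holds
  because every class has a representative and the map is undefined outside the cohomology.
\<close>

lemma ex1_induced_map_on_cohomology:
  assumes n: "n \<ge> 1"
  shows "\<exists>!T. T \<in> cohomology C d n \<rightarrow>\<^sub>E cohomology C' d' n \<and>
     (\<forall>f \<in> cocycles C d n. T (cohomology_class C d n f) = cohomology_class C' d' n (\<theta> n f)) \<and>
     (\<forall>X \<in> cohomology C d n. \<forall>Y \<in> cohomology C d n.
        T (cohomology_add C d n X Y) = cohomology_add C' d' n (T X) (T Y)) \<and>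
     (\<forall>c. \<forall>X \<in> cohomology C d n.
        T (cohomology_scale s C d n c X) = cohomology_scale s' C' d' n c (T X))"
proof (rule ex_ex1I)
  let ?H = "cohomology C d n" and ?H' = "cohomology C' d' n"
  let ?cl = "cohomology_class C d n" and ?cl' = "cohomology_class C' d' n"
  let ?Z = "cocycles C d n"
  define T where "T = (\<lambda>X\<in>?H. ?cl' (\<theta> n (SOME f. f \<in> ?Z \<and> X = ?cl f)))"
  have T: "T (?cl f) = ?cl' (\<theta> n f)" if f: "f \<in> ?Z" for f
  proof -
    define g where "g = (SOME g. g \<in> ?Z \<and> ?cl f = ?cl g)"
    have g: "g \<in> ?Z" "?cl f = ?cl g"
      using someI[of "\<lambda>g. g \<in> ?Z \<and> ?cl f = ?cl g" f] f by (auto simp: g_def)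
    then have "\<theta> n (f - g) \<in> coboundaries C' d' n"
      using map_coboundary[OF n] f n by (simp add: source.cohomology_class_eq_iff)
    then have "\<theta> n f - \<theta> n g \<in> coboundaries C' d' n"
      using f g n by (simp add: map_diff cocycles_def)
    then have "?cl' (\<theta> n f) = ?cl' (\<theta> n g)"
      using f g n by (simp add: target.cohomology_class_eq_iff map_cocycle)
    then show ?thesis
      using source.cohomology_class_in_cohomology[OF f] by (simp add: T_def g_def)
  qed
  have maps: "T \<in> ?H \<rightarrow>\<^sub>E ?H'"
  proof (rule PiE_I)
    fix X assume "X \<in> ?H"
    then obtain f where "f \<in> ?Z" "X = ?cl f" by (rule source.cohomology_cases)
    then show "T X \<in> ?H'"
      using n by (simp add: T target.cohomology_class_in_cohomology map_cocycle)
  qed (simp add: T_def)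
  have add: "T (cohomology_add C d n X Y) = cohomology_add C' d' n (T X) (T Y)"
    if XY: "X \<in> ?H" "Y \<in> ?H" for X Y
  proof -
    obtain f g where f: "f \<in> ?Z" "X = ?cl f" and g: "g \<in> ?Z" "Y = ?cl g"
      using XY source.cohomology_cases by metis
    moreover have "f + g \<in> ?Z"
      by (rule source.subspace_add[OF source.subspace_cocycles[OF n] f(1) g(1)])
    moreover have "\<theta> n (f + g) = \<theta> n f + \<theta> n g"
      using f g n by (simp add: map_add cocycles_def)
    ultimately show ?thesis
      using n by (simp add: source.cohomology_add_classes target.cohomology_add_classes T
          map_cocycle)
  qed
  have scale: "T (cohomology_scale s C d n c X) = cohomology_scale s' C' d' n c (T X)"
    if X: "X \<in> ?H" for c X
  proof -
    obtain f where f: "f \<in> ?Z" "X = ?cl f" using X source.cohomology_cases by metis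
    moreover have "s c f \<in> ?Z"
      by (rule source.subspace_scale[OF source.subspace_cocycles[OF n] f(1)])
    moreover have "\<theta> n (s c f) = s' c (\<theta> n f)"
      using f n by (simp add: map_scale cocycles_def)
    ultimately show ?thesis
      using n by (simp add: source.cohomology_scale_class target.cohomology_scale_class T
          map_cocycle)
  qed
  show "\<exists>T. T \<in> ?H \<rightarrow>\<^sub>E ?H' \<and>
     (\<forall>f \<in> ?Z. T (?cl f) = ?cl' (\<theta> n f)) \<and>
     (\<forall>X \<in> ?H. \<forall>Y \<in> ?H. T (cohomology_add C d n X Y) = cohomology_add C' d' n (T X) (T Y)) \<and>
     (\<forall>c. \<forall>X \<in> ?H. T (cohomology_scale s C d n c X) = cohomology_scale s' C' d' n c (T X))"
    by (intro exI[of _ T] conjI ballI allI maps T add scale)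
next
  fix T U
  assume T: "T \<in> cohomology C d n \<rightarrow>\<^sub>E cohomology C' d' n \<and>
     (\<forall>f \<in> cocycles C d n. T (cohomology_class C d n f) = cohomology_class C' d' n (\<theta> n f)) \<and>
     (\<forall>X \<in> cohomology C d n. \<forall>Y \<in> cohomology C d n.
        T (cohomology_add C d n X Y) = cohomology_add C' d' n (T X) (T Y)) \<and>
     (\<forall>c. \<forall>X \<in> cohomology C d n.
        T (cohomology_scale s C d n c X) = cohomology_scale s' C' d' n c (T X))"
  assume U: "U \<in> cohomology C d n \<rightarrow>\<^sub>E cohomology C' d' n \<and>
     (\<forall>f \<in> cocycles C d n. U (cohomology_class C d n f) = cohomology_class C' d' n (\<theta> n f)) \<and>
     (\<forall>X \<in> cohomology C d n. \<forall>Y \<in> cohomology C d n.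
        U (cohomology_add C d n X Y) = cohomology_add C' d' n (U X) (U Y)) \<and>
     (\<forall>c. \<forall>X \<in> cohomology C d n.
        U (cohomology_scale s C d n c X) = cohomology_scale s' C' d' n c (U X))"
  show "T = U"
  proof (rule PiE_ext)
    show "T \<in> cohomology C d n \<rightarrow>\<^sub>E cohomology C' d' n" using T by (rule conjunct1)
    show "U \<in> cohomology C d n \<rightarrow>\<^sub>E cohomology C' d' n" using U by (rule conjunct1)
    fix X assume "X \<in> cohomology C d n"
    then obtain f where f: "f \<in> cocycles C d n" and X: "X = cohomology_class C d n f"
      by (rule source.cohomology_cases)
    have "T X = cohomology_class C' d' n (\<theta> n f)"
      unfolding X by (rule T[THEN conjunct2, THEN conjunct1, THEN bspec, OF f])
    also have "\<dots> = U X"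
      unfolding X by (rule U[THEN conjunct2, THEN conjunct1, THEN bspec, OF f, symmetric])
    finally show "T X = U X" .
  qed
qed

end


section \<open>Complexes of tuples\<close>

text \<open>
  Since tuples vanish outside \<open>{1..n}\<close>, the boundary cases of the differential are instances of the
  generic component, with a zero summand.
\<close>

lemma tuple_differential_apply:
  assumes F: "F \<in> tuples C n" and n: "n \<ge> 1"
    and zero: "d1 n 0 = 0" "d2 n 0 = 0"
  shows "tuple_differential d1 d2 n F i = (if i = 0 then 0 else d2 n (F (i - 1)) + d1 n (F i))"
proof -
  have F0: "F j = 0" if "j = 0 \<or> j > n" for j
    using F that by (auto simp: tuples_def)
  consider "i = 0" | "i = 1" | "2 \<le> i" "i \<le> n" | "i = n + 1" | "i > n + 1" by linarith
  then show ?thesis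
    using n by cases (simp_all add: tuple_differential_def F0 zero)
qed

lemma vector_space_tuple_scale:
  assumes "vector_space sM"
  shows "vector_space (tuple_scale sM)"
proof -
  interpret vector_space sM by fact
  show ?thesis
    by unfold_locales (auto simp: tuple_scale_def fun_eq_iff algebra_simps)
qed

text \<open>
  Arranging a tuple as a polynomial \<open>\<Sum> f\<^sub>i t\<^sup>i\<close> turns the tuple differential into \<open>d1 +
      t d2\<close>. Its square
  vanishes when the three coefficients \<open>d1 d1\<close>, \<open>d1 d2 + d2 d1\<close> and \<open>d2 d2\<close> do.
\<close>

lemma cochain_complex_tuples:
  assumes s: "vector_space sM"
    and sub: "\<And>n. n \<ge> 1 \<Longrightarrow> module.subspace (\<lambda>c f xs. sM c (f xs)) (C n)"
    and into: "\<And>n f. n \<ge> 1 \<Longrightarrow> f \<in> C n \<Longrightarrow> d1 n f \<in> C (Suc n)"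
              "\<And>n f. n \<ge> 1 \<Longrightarrow> f \<in> C n \<Longrightarrow> d2 n f \<in> C (Suc n)"
    and add: "\<And>n f g. d1 n (f + g) = d1 n f + d1 n g" "\<And>n f g. d2 n (f + g) = d2 n f + d2 n g"
    and scale: "\<And>n c f. d1 n (\<lambda>xs. sM c (f xs)) = (\<lambda>xs. sM c (d1 n f xs))"
               "\<And>n c f. d2 n (\<lambda>xs. sM c (f xs)) = (\<lambda>xs. sM c (d2 n f xs))"
    and square: "\<And>n f. n \<ge> 1 \<Longrightarrow> f \<in> C n \<Longrightarrow> d1 (Suc n) (d1 n f) = 0"
                "\<And>n f. n \<ge> 1 \<Longrightarrow> f \<in> C n \<Longrightarrow> d2 (Suc n) (d2 n f) = 0"
                "\<And>n f. n \<ge> 1 \<Longrightarrow> f \<in> C n \<Longrightarrow> d1 (Suc n) (d2 n f) + d2 (Suc n) (d1 n f) = 0"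
  shows "cochain_complex (tuple_scale sM) (tuples C) (tuple_differential d1 d2)"
proof -
  interpret M: vector_space sM by fact
  interpret V: vector_space "tuple_scale sM"
    by (rule vector_space_tuple_scale) fact
  interpret F: vector_space "\<lambda>c (f :: 'c list \<Rightarrow> 'b) xs. sM c (f xs)"
    by unfold_locales (auto simp: fun_eq_iff algebra_simps)
  have zero: "d1 n 0 = 0" "d2 n 0 = 0" for n
    using add(1)[of n 0 0] add(2)[of n 0 0] by simp_all
  note D = tuple_differential_apply[where ?d1.0 = d1 and ?d2.0 = d2, OF _ _ zero]
  have comp: "F i \<in> C n" if "F \<in> tuples C n" "n \<ge> 1" for F n i
    using that F.subspace_0[OF sub[OF that(2)]] by (cases "i \<in> {1..n}") (auto simp: tuples_def)
  have tuplesI: "F \<in> tuples C n" if "\<And>i. F i \<in> C n" "\<And>i. i = 0 \<or> i > n \<Longrightarrow> F i = 0" for F n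
    using that by (auto simp: tuples_def)
  have outside: "F i = 0" if "F \<in> tuples C n" "i = 0 \<or> i > n" for F n i
    using that by (auto simp: tuples_def)
  have subT: "V.subspace (tuples C n)" if n: "n \<ge> 1" for n
    using F.subspace_0[OF sub[OF n]] F.subspace_add[OF sub[OF n]] F.subspace_scale[OF sub[OF n]]
    by (auto simp: V.subspace_def tuples_def tuple_scale_def zero_fun_def)
  have intoT: "tuple_differential d1 d2 n F \<in> tuples C (Suc n)" if n: "n \<ge> 1" and F:
      "F \<in> tuples C n" for n F
  proof (rule tuplesI)
    note S = sub[of "Suc n"]
    show "tuple_differential d1 d2 n F i \<in> C (Suc n)" for i
      using F n by (simp add: D F.subspace_0[OF S] F.subspace_add[OF S] into comp)
    show "tuple_differential d1 d2 n F i = 0" if "i = 0 \<or> i > Suc n" for i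
      using that F n outside[OF F] by (auto simp: D zero)
  qed
  have linT: "linear_map_on (tuple_scale sM) (tuple_scale sM) (tuples C n) (tuple_differential
      d1 d2 n)"
    if n: "n \<ge> 1" for n
    unfolding linear_map_on_def
  proof (intro conjI ballI allI ext)
    fix F G i xs assume "F \<in> tuples C n" "G \<in> tuples C n"
    then show "tuple_differential d1 d2 n (F + G) i xs =
        (tuple_differential d1 d2 n F + tuple_differential d1 d2 n G) i xs"
      using n V.subspace_add[OF subT[OF n], of F G] by (simp add: D add)
  next
    fix c F i xs assume "F \<in> tuples C n"
    then show "tuple_differential d1 d2 n (tuple_scale sM c F) i xs =
        tuple_scale sM c (tuple_differential d1 d2 n F) i xs"
      using n V.subspace_scale[OF subT[OF n], of F c]
      by (simp add: D) (simp add: tuple_scale_def D scale M.scale_right_distrib)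
  qed
  have sqT: "tuple_differential d1 d2 (Suc n) (tuple_differential d1 d2 n F) = 0"
    if n: "n \<ge> 1" and F: "F \<in> tuples C n" for n F
  proof
    fix i
    let ?G = "tuple_differential d1 d2 n F"
    have "tuple_differential d1 d2 (Suc n) ?G i =
        (if i = 0 then 0 else d2 (Suc n) (?G (i - 1)) + d1 (Suc n) (?G i))"
      using D[OF intoT[OF n F]] by simp
    also have "\<dots> = 0"
    proof (cases "i \<le> 1")
      case True
      then show ?thesis
        using n F by (cases i) (simp_all add: D zero outside[OF F] square comp)
    next
      case False
      then obtain j where i: "i = Suc (Suc j)" by (cases i; cases "i - 1") auto
      have "d2 (Suc n) (?G (i - 1)) + d1 (Suc n) (?G i) =
          d2 (Suc n) (d2 n (F j)) + (d1 (Suc n) (d2 n (F (Suc j))) + d2 (Suc n) (d1 n (F (Suc j))))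
          + d1 (Suc n) (d1 n (F (Suc (Suc j))))"
        using n F by (simp add: i D add add_ac)
      then show ?thesis
        using n F by (simp add: square comp)
    qed
    finally show "tuple_differential d1 d2 (Suc n) ?G i = 0 i" by simp
  qed
  show ?thesis
    by unfold_locales (use subT intoT linT sqT in auto)
qed

context compatible_hom_bimodule
begin

abbreviation "\<delta>1 \<equiv> hom_assoc_differential sM \<mu>1 \<alpha> l1 r1"
abbreviation "\<delta>2 \<equiv> hom_assoc_differential sM \<mu>2 \<alpha> l2 r2"

text \<open>
  Polarization of \<open>\<delta> \<delta> = 0\<close>, applied to the sum of the two bimodule structures.
\<close>

lemma hom_assoc_differentials_anticommute:
  assumes f: "f \<in> hom_assoc_cochains sA sM \<alpha> \<beta> n" and n: "n \<ge> 1"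
  shows "\<delta>1 (Suc n) (\<delta>2 n f) + \<delta>2 (Suc n) (\<delta>1 n f) = 0"
proof -
  interpret S: hom_bimodule sA sM "\<lambda>a b. \<mu>1 a b + \<mu>2 a b" \<alpha> "\<lambda>a m. l1 a m + l2 a m"
      "\<lambda>m a. r1 m a + r2 m a" \<beta>
    by (rule hom_bimodule_sum)
  let ?\<delta> = "hom_assoc_differential sM (\<lambda>a b. \<mu>1 a b + \<mu>2 a b) \<alpha> (\<lambda>a m. l1 a m +
      l2 a m) (\<lambda>m a. r1 m a + r2 m a)"
  have sum: "?\<delta> m g = \<delta>1 m g + \<delta>2 m g" if "g \<in> hom_assoc_cochains sA sM \<alpha> \<beta> m" for m g
    using that by (intro hom_assoc_differential_sum[OF mod1.vector_space_module, where sA =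
        sA]) (simp add: hom_assoc_cochains_def)
  have "0 = ?\<delta> (Suc n) (?\<delta> n f)"
    by (rule S.hom_assoc_differential_square[OF f n, symmetric])
  also have "\<dots> = \<delta>1 (Suc n) (?\<delta> n f) + \<delta>2 (Suc n) (?\<delta> n f)"
    by (rule sum[OF S.hom_assoc_differential_cochain[OF f n]])
  also have "\<dots> = \<delta>1 (Suc n) (\<delta>1 n f) + \<delta>2 (Suc n) (\<delta>2 n f) + (\<delta>1 (Suc n) (\<delta>2 n f) +
      \<delta>2 (Suc n) (\<delta>1 n f))"
    by (simp only: sum[OF f] mod1.hom_assoc_differential_add mod2.hom_assoc_differential_add add_ac)
  finally show ?thesis
    by (simp add: mod1.hom_assoc_differential_square[OF f n]
        mod2.hom_assoc_differential_square[OF f n])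
qed

lemma cochain_complex_compatible_assoc:
  "cochain_complex (tuple_scale sM) (compatible_assoc_cochains sA sM \<alpha> \<beta>)
     (compatible_assoc_differential sM \<mu>1 \<mu>2 \<alpha> l1 r1 l2 r2)"
  unfolding compatible_assoc_cochains_def compatible_assoc_differential_def
  by (rule cochain_complex_tuples)
    (simp_all only: mod1.vector_space_module mod1.vector_space_algebra mod1.linear_mod_twist
      subspace_hom_assoc_cochains mod1.hom_assoc_differential_cochain
          mod2.hom_assoc_differential_cochain
      mod1.hom_assoc_differential_add mod2.hom_assoc_differential_add
          mod1.hom_assoc_differential_scale
      mod2.hom_assoc_differential_scale mod1.hom_assoc_differential_square
          mod2.hom_assoc_differential_square
      hom_assoc_differentials_anticommute)

text \<open>
  Preimages are chosen componentwise and set to zero outside \<open>{1..n}\<close>.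
\<close>

lemma skew_map_onto:
  "skew_map sM n ` compatible_assoc_cochains sA sM \<alpha> \<beta> n = compatible_lie_cochains sA sM \<alpha> \<beta> n"
proof (intro equalityI subsetI)
  note onto = skew_symmetrization_cochains_onto[OF mod1.vector_space_algebra
      mod1.linear_mod_twist, of n \<alpha>]
  interpret M: vector_space sM by (rule mod1.vector_space_module)
  have zero: "skew_symmetrization sM n 0 = 0"
    by (auto simp: skew_symmetrization_def fun_eq_iff)
  fix G
  {
    assume "G \<in> skew_map sM n ` compatible_assoc_cochains sA sM \<alpha> \<beta> n"
    then obtain F where F: "F \<in> tuples (hom_assoc_cochains sA sM \<alpha> \<beta>) n" and G: "G =
        skew_map sM n F"
      by (auto simp: compatible_assoc_cochains_def)
    have "skew_symmetrization sM n (F i) \<in> hom_lie_cochains sA sM \<alpha> \<beta> n" if "i \<in> {1..n}" for i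
      using F that onto by (auto simp: tuples_def)
    then show "G \<in> compatible_lie_cochains sA sM \<alpha> \<beta> n"
      using F by (auto simp: compatible_lie_cochains_def tuples_def skew_map_def G zero)
  }
  {
    assume G: "G \<in> compatible_lie_cochains sA sM \<alpha> \<beta> n"
    have "\<exists>f. f \<in> hom_assoc_cochains sA sM \<alpha> \<beta> n \<and> skew_symmetrization sM n f = G i" if
        "i \<in> {1..n}" for i
    proof -
      have "G i \<in> skew_symmetrization sM n ` hom_assoc_cochains sA sM \<alpha> \<beta> n"
        using G that unfolding onto by (simp add: compatible_lie_cochains_def tuples_def)
      then show ?thesis by auto
    qed
    then obtain f where f: "\<And>i. i \<in> {1..n} \<Longrightarrow> f i \<in> hom_assoc_cochains sA sM \<alpha> \<beta> n \<and>
        skew_symmetrization sM n (f i) = G i"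
      by metis
    define F where "F = (\<lambda>i. if i \<in> {1..n} then f i else 0)"
    have "F \<in> compatible_assoc_cochains sA sM \<alpha> \<beta> n"
      using f by (simp add: F_def compatible_assoc_cochains_def tuples_def)
    moreover have "G = skew_map sM n F"
      using f G by (auto simp: F_def skew_map_def fun_eq_iff zero compatible_lie_cochains_def
          tuples_def)
    ultimately show "G \<in> skew_map sM n ` compatible_assoc_cochains sA sM \<alpha> \<beta> n"
      by (intro rev_image_eqI)
  }
qed

lemma skew_map_differential:
  assumes F: "F \<in> compatible_assoc_cochains sA sM \<alpha> \<beta> n" and n: "n \<ge> 1"
  shows "skew_map sM (Suc n) (compatible_assoc_differential sM \<mu>1 \<mu>2 \<alpha> l1 r1 l2 r2 n F) =
    compatible_lie_differential sM (commutator \<mu>1) (commutator \<mu>2) \<alpha>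
      (commutator_action l1 r1) (commutator_action l2 r2) n (skew_map sM n F)"
proof
  fix i
  note M = mod1.vector_space_module
  interpret M: vector_space sM by (rule M)
  have zero: "skew_symmetrization sM (Suc n) 0 = 0"
    by (auto simp: skew_symmetrization_def fun_eq_iff)
  have comp: "F j \<in> multilinear_maps sA sM n" if "1 \<le> j" "j \<le> n" for j
    using F that by (simp add: compatible_assoc_cochains_def tuples_def hom_assoc_cochains_def)
  consider "i = 1" | "2 \<le> i" "i \<le> n" | "i = n + 1" | "i = 0" | "n + 1 < i"
    by linarith
  then show "skew_map sM (Suc n) (compatible_assoc_differential sM \<mu>1 \<mu>2 \<alpha> l1 r1 l2 r2 n F) i =
    compatible_lie_differential sM (commutator \<mu>1) (commutator \<mu>2) \<alpha>
      (commutator_action l1 r1) (commutator_action l2 r2) n (skew_map sM n F) i"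
    using n comp
    by cases (simp_all add: skew_map_def compatible_assoc_differential_def
        compatible_lie_differential_def
        tuple_differential_def zero skew_symmetrization_add[OF M]
        mod1.skew_symmetrization_differential mod2.skew_symmetrization_differential)
qed

lemma cochain_map_skew_map:
  "cochain_map (tuple_scale sM) (compatible_assoc_cochains sA sM \<alpha> \<beta>)
     (compatible_assoc_differential sM \<mu>1 \<mu>2 \<alpha> l1 r1 l2 r2)
     (tuple_scale sM) (compatible_lie_cochains sA sM \<alpha> \<beta>)
     (compatible_lie_differential sM (commutator \<mu>1) (commutator \<mu>2) \<alpha>
        (commutator_action l1 r1) (commutator_action l2 r2))
     (skew_map sM)"
proof (rule cochain_map_onto)
  show "linear_map_on (tuple_scale sM) (tuple_scale sM) (compatible_assoc_cochains sA sM \<alpha> \<beta> n)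
      (skew_map sM n)" for n
    by (simp add: linear_map_on_def skew_map_def tuple_scale_def fun_eq_iff
        skew_symmetrization_add[OF mod1.vector_space_module]
        skew_symmetrization_scale[OF mod1.vector_space_module])
qed (rule cochain_complex_compatible_assoc vector_space_tuple_scale mod1.vector_space_module
    skew_map_onto skew_map_differential | assumption)+

end


section \<open>The morphism and its induced map on cohomology\<close>

theorem theorem3p4:
  fixes sA :: "'k::field_char_0 \<Rightarrow> 'a::ab_group_add \<Rightarrow> 'a"
    and sM :: "'k \<Rightarrow> 'm::ab_group_add \<Rightarrow> 'm"
    and BA :: "'a set" and BM :: "'m set"
    and \<mu>1 \<mu>2 :: "'a \<Rightarrow> 'a \<Rightarrow> 'a" and \<alpha> :: "'a \<Rightarrow> 'a"
    and l1 l2 :: "'a \<Rightarrow> 'm \<Rightarrow> 'm" and r1 r2 :: "'m \<Rightarrow> 'a \<Rightarrow> 'm" and \<beta> :: "'m \<Rightarrow> 'm"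
  defines "C \<equiv> compatible_assoc_cochains sA sM \<alpha> \<beta>"
    and "\<delta> \<equiv> compatible_assoc_differential sM \<mu>1 \<mu>2 \<alpha> l1 r1 l2 r2"
    and "C' \<equiv> compatible_lie_cochains sA sM \<alpha> \<beta>"
    and "\<delta>' \<equiv> compatible_lie_differential sM (commutator \<mu>1) (commutator \<mu>2) \<alpha>
                (commutator_action l1 r1) (commutator_action l2 r2)"
    and "s \<equiv> tuple_scale sM"
    and "\<Theta> \<equiv> skew_map sM"
  assumes "finite_dimensional_vector_space sA BA"
    and "finite_dimensional_vector_space sM BM"
    and "compatible_hom_assoc_algebra sA \<mu>1 \<mu>2 \<alpha>"
    and "compatible_hom_bimodule sA sM \<mu>1 \<mu>2 \<alpha> l1 r1 l2 r2 \<beta>"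
  shows "compatible_hom_lie_algebra sA (commutator \<mu>1) (commutator \<mu>2) \<alpha> \<and>
    compatible_hom_lie_representation sA sM (commutator \<mu>1) (commutator \<mu>2) \<alpha>
           (commutator_action l1 r1) (commutator_action l2 r2) \<beta> \<and>
    cochain_map s C \<delta> s C' \<delta>' \<Theta> \<and>
    (\<forall>n\<ge>1. \<exists>!T. T \<in> cohomology C \<delta> n \<rightarrow>\<^sub>E cohomology C' \<delta>' n \<and>
           (\<forall>F \<in> cocycles C \<delta> n.
              T (cohomology_class C \<delta> n F) = cohomology_class C' \<delta>' n (\<Theta> n F)) \<and>
           (\<forall>X \<in> cohomology C \<delta> n. \<forall>Y \<in> cohomology C \<delta> n.
              T (cohomology_add C \<delta> n X Y) = cohomology_add C' \<delta>' n (T X) (T Y)) \<and>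
           (\<forall>c. \<forall>X \<in> cohomology C \<delta> n.
              T (cohomology_scale s C \<delta> n c X) = cohomology_scale s C' \<delta>' n c (T X)))"
proof -
  interpret compatible_hom_bimodule sA sM \<mu>1 \<mu>2 \<alpha> l1 r1 l2 r2 \<beta> by fact
  interpret \<Theta>: cochain_map s C \<delta> s C' \<delta>' \<Theta>
    unfolding C_def \<delta>_def C'_def \<delta>'_def s_def \<Theta>_def by (rule cochain_map_skew_map)
  show ?thesis
    using compatible_hom_lie_algebra_commutator compatible_hom_lie_representation_commutator
      \<Theta>.cochain_map_axioms \<Theta>.ex1_induced_map_on_cohomology
    by blast
qed

end
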